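(* Let $(X,d,\mu)$ and $(X',d',\mu')$ be spaces with metrics $d$ and $d'$ and locally finite Borel measures $\mu$ and $\mu'$, and let $D\subset X$ and $D'\subset X'$ be domains with finite Hausdorff dimensions $\alpha$ and $\alpha'>1$, respectively. Let $X$ be upper $\lambda(r)$-regular at a point $x_0\in\partial D$, where $D$ and $D'$ have weakly flat boundaries, let $\overline{D}$ and $\overline{D'}$ be compact, and let $Q:D\to[0,\infty]$ be a function of the class $L^1_\mu(D)$ satisfying the condition $$\limsup_{\varepsilon\to 0}\frac{1}{\mu(B(x_0,\varepsilon)\cap D)}\int_{B(x_0,\varepsilon)\cap D}Q(x)\,d\mu(x)<\infty .$$ If $$\lambda(\varepsilon)=o\left(\varepsilon^{\alpha}\log^{\alpha-1}\frac{1}{\varepsilon}\right)\quad\text{as }\varepsilon\to 0,$$ then any $Q$-homeomorphism $f:D\to D'$ extends to a homeomorphism $\overline{f}:\overline{D}\to\overline{D'}$.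
   Context: A domain is an open path connected set. $B(x_0,r)=\{x\in X: d(x,x_0)<r\}$. Upper $\lambda(r)$-regularity: $(X,d,\mu)$ is upper $\lambda(r)$-regular at a point $x_0\in X$ if there is a constant $C>0$ such that $\mu(B(x_0,r))\le C\lambda_{x_0}(r)$ for the balls $B(x_0,r)$ centered at $x_0$ with all radii $r<r_0$ for some $r_0>0$, where $\lambda=\lambda_{x_0}$ is an increasing function. Modulus: a Borel function $\varrho:X\to[0,\infty]$ is admissible for a family $\Gamma$ of paths in $X$ (written $\varrho\in\mathrm{adm}\,\Gamma$) if $\int_\gamma\varrho\,ds\ge 1$ for all $\gamma\in\Gamma$. For a family $\Gamma$ of paths in a domain $D\subset X$ of Hausdorff dimension $\alpha$, the modulus is $M(\Gamma)=\inf_{\varrho\in\mathrm{adm}\,\Gamma}\int_D\varrho^{\alpha}(x)\,d\mu(x)$. For path families in $D'\subset X'$ the modulus is defined in the same way with $D'$, $\mu'$ and the Hausdorff dimension $\alpha'$ of $D'$ in place of $D$, $\mu$, $\alpha$. $Q$-homeomorphism: for a measurable function $Q:D\to[0,\infty]$, a homeomorphism $f:D\to D'$ is a $Q$-homeomorphism if $M(f\Gamma)\le\int_D Q(x)\varrho^{\alpha}(x)\,d\mu(x)$ for every family $\Gamma$ of paths in $D$ and every admissible function $\varrho$ for $\Gamma$. A continuum is a compact connected space. $\Delta(E,F;D)$ denotes the family of all paths joining $E$ and $F$ in $D$. Weakly flat boundary: the boundary of a domain $D$ is weakly flat at a point $x_0\in\partial D$ if, for every number $P>0$ and every neighborhood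 $U$ of $x_0$, there is a neighborhood $V\subset U$ of $x_0$ such that $M(\Delta(E,F;D))\ge P$ for all continua $E$ and $F$ in $D$ intersecting $\partial U$ and $\partial V$. The boundary $\partial D$ is weakly flat if this holds at every point of $\partial D$. The same definition is used for $D'$ in $X'$.
   Formalization: The upper regularity of X, the limsup condition on Q and the growth condition on λ are required at every point x_0 of ∂D (with λ depending on x_0); with only one such point the claim fails, e.g. for a punctured disc mapped onto an annulus. *)

theory Defs
  imports "HOL-Analysis.Analysis" "HOL-Library.Landau_Symbols"
begin

text \<open>
  A space \<open>(X, d, \<mu>)\<close> is a type of class \<^class>\<open>metric_space\<close> with a measure on its Borel sets;
  the whole space \<open>X\<close> is the type universe.
\<close>

definition locally_finite_borel :: "'a::metric_space measure \<Rightarrow> bool" where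
  "locally_finite_borel \<mu> \<longleftrightarrow>
     sets \<mu> = sets borel \<and> (\<forall>x. \<exists>r>0. emeasure \<mu> (ball x r) < \<infinity>)"

definition domain :: "'a::metric_space set \<Rightarrow> bool" where
  "domain D \<longleftrightarrow> open D \<and> path_connected D"

text \<open>Real powers on \<open>[0,\<infinity>]\<close>, for exponents \<open>a \<ge> 0\<close>, with \<open>x\<^sup>0 = 1\<close> for every \<open>x\<close>
  (\<^const>\<open>powr\<close> has \<open>0 powr 0 = 0\<close>).\<close>

definition epowr :: "ennreal \<Rightarrow> real \<Rightarrow> ennreal" where
  "epowr x a = (if a = 0 then 1 else if x = \<infinity> then \<infinity> else ennreal (enn2real x powr a))"


subsection \<open>Hausdorff dimension\<close>

text \<open>Covers are required to consist of bounded sets because \<^const>\<open>diameter\<close> is real-valued and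
  carries no information on unbounded sets. Empty members of a cover contribute \<open>0\<close>, also
  for \<open>s = 0\<close>.\<close>

definition hausdorff_premeasure :: "real \<Rightarrow> real \<Rightarrow> 'a::metric_space set \<Rightarrow> ennreal" where
  "hausdorff_premeasure \<delta> s A =
     (INF C \<in> {C :: nat \<Rightarrow> 'a set. A \<subseteq> (\<Union>i. C i) \<and> (\<forall>i. bounded (C i) \<and> diameter (C i) \<le> \<delta>)}.
        \<Sum>i. if C i = {} then 0 else epowr (ennreal (diameter (C i))) s)"

definition hausdorff_measure :: "real \<Rightarrow> 'a::metric_space set \<Rightarrow> ennreal" where
  "hausdorff_measure s A = (SUP \<delta> \<in> {0<..}. hausdorff_premeasure \<delta> s A)"

definition hausdorff_dim :: "'a::metric_space set \<Rightarrow> ereal" where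
  "hausdorff_dim A = (INF s \<in> {s. 0 \<le> s \<and> hausdorff_measure s A = 0}. ereal s)"


subsection \<open>Length and line integrals\<close>

definition arc_length :: "(real \<Rightarrow> 'a::metric_space) \<Rightarrow> real \<Rightarrow> real \<Rightarrow> ennreal" where
  "arc_length \<gamma> a b =
     (SUP (n, t) \<in> {(n :: nat, t :: nat \<Rightarrow> real). mono_on {..n} t \<and> t ` {..n} \<subseteq> {a..b}}.
        \<Sum>i<n. ennreal (dist (\<gamma> (t i)) (\<gamma> (t (Suc i)))))"

definition rectifiable :: "(real \<Rightarrow> 'a::metric_space) \<Rightarrow> bool" where
  "rectifiable \<gamma> \<longleftrightarrow> arc_length \<gamma> 0 1 < \<infinity>"

text \<open>The normal (arc length) representation \<open>\<gamma>\<^sup>0\<close> of a rectifiable path, i.e. the unique map on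
  \<open>[0, length \<gamma>]\<close> such that \<open>\<gamma> t = \<gamma>\<^sup>0 (arc_length \<gamma> 0 t)\<close> for \<open>t \<in> [0,1]\<close>.\<close>

definition normal_rep :: "(real \<Rightarrow> 'a::metric_space) \<Rightarrow> real \<Rightarrow> 'a" where
  "normal_rep \<gamma> s = (THE x. \<exists>t\<in>{0..1}. arc_length \<gamma> 0 t = ennreal s \<and> \<gamma> t = x)"

text \<open>Non-rectifiable paths get the value \<open>\<infinity>\<close>, so that, as usual, they impose no restriction on
  admissible functions.\<close>

definition line_integral :: "(real \<Rightarrow> 'a::metric_space) \<Rightarrow> ('a \<Rightarrow> ennreal) \<Rightarrow> ennreal" where
  "line_integral \<gamma> \<rho> =
     (if rectifiable \<gamma>
      then \<integral>\<^sup>+ s \<in> {0..enn2real (arc_length \<gamma> 0 1)}. \<rho> (normal_rep \<gamma> s) \<partial>lborel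
      else \<infinity>)"


subsection \<open>Modulus of path families\<close>

definition admissible :: "(real \<Rightarrow> 'a::metric_space) set \<Rightarrow> ('a \<Rightarrow> ennreal) set" where
  "admissible \<Gamma> = {\<rho> \<in> borel_measurable borel. \<forall>\<gamma>\<in>\<Gamma>. line_integral \<gamma> \<rho> \<ge> 1}"

definition paths_in :: "'a::metric_space set \<Rightarrow> (real \<Rightarrow> 'a) set" where
  "paths_in D = {\<gamma>. path \<gamma> \<and> path_image \<gamma> \<subseteq> D}"

text \<open>The exponent \<open>\<alpha>\<close> is meant to be the Hausdorff dimension of \<open>D\<close>.\<close>

definition modulus ::
    "'a::metric_space measure \<Rightarrow> 'a set \<Rightarrow> real \<Rightarrow> (real \<Rightarrow> 'a) set \<Rightarrow> ennreal" where
  "modulus \<mu> D \<alpha> \<Gamma> = (INF \<rho> \<in> admissible \<Gamma>. \<integral>\<^sup>+ x \<in> D. epowr (\<rho> x) \<alpha> \<partial>\<mu>)"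

definition joining_paths :: "'a::metric_space set \<Rightarrow> 'a set \<Rightarrow> 'a set \<Rightarrow> (real \<Rightarrow> 'a) set" where
  "joining_paths E F D = {\<gamma> \<in> paths_in D. pathstart \<gamma> \<in> E \<and> pathfinish \<gamma> \<in> F}"


subsection \<open>Weakly flat boundaries\<close>

definition weakly_flat_at ::
    "'a::metric_space measure \<Rightarrow> 'a set \<Rightarrow> real \<Rightarrow> 'a \<Rightarrow> bool" where
  "weakly_flat_at \<mu> D \<alpha> x0 \<longleftrightarrow>
     (\<forall>P::real. \<forall>U. 0 < P \<and> open U \<and> x0 \<in> U \<longrightarrow>
       (\<exists>V. open V \<and> x0 \<in> V \<and> V \<subseteq> U \<and>
         (\<forall>E F. compact E \<and> connected E \<and> E \<subseteq> D \<and> compact F \<and> connected F \<and> F \<subseteq> D \<and>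
                E \<inter> frontier U \<noteq> {} \<and> E \<inter> frontier V \<noteq> {} \<and>
                F \<inter> frontier U \<noteq> {} \<and> F \<inter> frontier V \<noteq> {} \<longrightarrow>
            modulus \<mu> D \<alpha> (joining_paths E F D) \<ge> ennreal P)))"

definition weakly_flat_boundary :: "'a::metric_space measure \<Rightarrow> 'a set \<Rightarrow> real \<Rightarrow> bool" where
  "weakly_flat_boundary \<mu> D \<alpha> \<longleftrightarrow> (\<forall>x0\<in>frontier D. weakly_flat_at \<mu> D \<alpha> x0)"


subsection \<open>Upper regularity and $Q$-homeomorphisms\<close>

definition upper_regular_at ::
    "'a::metric_space measure \<Rightarrow> (real \<Rightarrow> real) \<Rightarrow> 'a \<Rightarrow> bool" where
  "upper_regular_at \<mu> l x0 \<longleftrightarrow>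
     (\<exists>C>0. \<exists>r0>0. mono_on {0<..<r0} l \<and>
        (\<forall>r\<in>{0<..<r0}. 0 \<le> l r \<and> emeasure \<mu> (ball x0 r) \<le> ennreal (C * l r)))"

text \<open>Measurability of \<open>Q\<close> is \<open>\<mu>\<close>-measurability, i.e. with respect to the completion of \<open>\<mu>\<close>;
  \<^const>\<open>nn_integral\<close> does not distinguish \<open>\<mu>\<close> from its completion.\<close>

definition measurable_on_domain :: "'a::metric_space measure \<Rightarrow> 'a set \<Rightarrow> ('a \<Rightarrow> ennreal) \<Rightarrow> bool" where
  "measurable_on_domain \<mu> D Q \<longleftrightarrow> Q \<in> borel_measurable (restrict_space (completion \<mu>) D)"

definition Q_homeomorphism ::
    "'a::metric_space measure \<Rightarrow> 'a set \<Rightarrow> real \<Rightarrow> 'b::metric_space measure \<Rightarrow> 'b set \<Rightarrow> real \<Rightarrow>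
     ('a \<Rightarrow> ennreal) \<Rightarrow> ('a \<Rightarrow> 'b) \<Rightarrow> bool" where
  "Q_homeomorphism \<mu> D \<alpha> \<mu>' D' \<alpha>' Q f \<longleftrightarrow>
     measurable_on_domain \<mu> D Q \<and>
     (\<exists>g. homeomorphism D D' f g) \<and>
     (\<forall>\<Gamma> \<rho>. \<Gamma> \<subseteq> paths_in D \<and> \<rho> \<in> admissible \<Gamma> \<longrightarrow>
        modulus \<mu>' D' \<alpha>' ((\<lambda>\<gamma>. f \<circ> \<gamma>) ` \<Gamma>) \<le> (\<integral>\<^sup>+ x \<in> D. Q x * epowr (\<rho> x) \<alpha> \<partial>\<mu>))"

end

theory Submission
  imports Defs
begin

text \<open>
  A weakly flat boundary makes \<open>D\<close> locally path connected at each \<open>x0 \<in> \<partial>D\<close>: nearby points that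
  could only be joined through the outside of a ball would lie on continua joined by a family of
  bounded modulus. Hence oscillation of \<open>f\<close> at \<open>x0\<close> is seen on small continua \<open>C\<close> near \<open>x0\<close>
  with large images, and weak flatness of \<open>\<partial>D'\<close> bounds the modulus of the paths from \<open>f C\<close> to the
  image of a fixed continuum from below by \<open>1\<close>. The growth condition on \<open>\<lambda>\<close> makes the energy of a
  radial density close to \<open>1 / (t log (1/t))\<close> smaller than that, so \<open>f\<close> has limits on \<open>\<partial>D\<close>.
  Distinct boundary points have distinct limits, because \<open>Q \<in> L\<^sup>1\<close> bounds the modulus of paths
  between their neighbourhoods, whereas a common limit would make it infinite. Only radial step
  densities are needed; their line integrals are estimated from below via the \<open>1\<close>-Lipschitz
  normal representation.
\<close>

subsection \<open>Arc length\<close>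

lemma arc_length_upper:
  assumes "mono_on {..n} t" "t ` {..n} \<subseteq> {a..b}"
  shows "(\<Sum>i<n. ennreal (dist (\<gamma> (t i)) (\<gamma> (t (Suc i))))) \<le> arc_length \<gamma> a b"
  unfolding arc_length_def
  by (rule SUP_upper2[where i="(n,t)"]) (use assms in auto)

lemma arc_length_least:
  assumes "\<And>n t. mono_on {..n} t \<Longrightarrow> t ` {..n} \<subseteq> {a..b} \<Longrightarrow>
             (\<Sum>i<n. ennreal (dist (\<gamma> (t i)) (\<gamma> (t (Suc i))))) \<le> B"
  shows "arc_length \<gamma> a b \<le> B"
  unfolding arc_length_def by (rule SUP_least) (use assms in auto)

lemma arc_length_mono:
  assumes "a' \<le> a" "b \<le> b'"
  shows "arc_length \<gamma> a b \<le> arc_length \<gamma> a' b'"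
  by (rule arc_length_least, rule arc_length_upper) (use assms in force)+

lemma arc_length_cong:
  assumes "\<And>t. t \<in> {a..b} \<Longrightarrow> \<gamma> t = \<gamma>' t"
  shows "arc_length \<gamma> a b = arc_length \<gamma>' a b"
proof -
  have "arc_length \<gamma> a b \<le> arc_length \<gamma>' a b"
    if eq: "\<And>t. t \<in> {a..b} \<Longrightarrow> \<gamma> t = \<gamma>' t" for \<gamma> \<gamma>' :: "real \<Rightarrow> 'a"
  proof (rule arc_length_least)
    fix n and t :: "nat \<Rightarrow> real" assume t: "mono_on {..n} t" "t ` {..n} \<subseteq> {a..b}"
    have "(\<Sum>i<n. ennreal (dist (\<gamma> (t i)) (\<gamma> (t (Suc i))))) =
          (\<Sum>i<n. ennreal (dist (\<gamma>' (t i)) (\<gamma>' (t (Suc i)))))"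
    proof (rule sum.cong)
      fix i assume "i \<in> {..<n}"
      then have "t i \<in> {a..b}" "t (Suc i) \<in> {a..b}" using t(2) by (auto simp: image_subset_iff)
      then show "ennreal (dist (\<gamma> (t i)) (\<gamma> (t (Suc i)))) =
                 ennreal (dist (\<gamma>' (t i)) (\<gamma>' (t (Suc i))))" by (simp add: eq)
    qed simp
    then show "(\<Sum>i<n. ennreal (dist (\<gamma> (t i)) (\<gamma> (t (Suc i))))) \<le> arc_length \<gamma>' a b"
      using arc_length_upper[OF t] by simp
  qed
  from this[of \<gamma> \<gamma>'] this[of \<gamma>' \<gamma>] show ?thesis using assms by (simp add: order_antisym)
qed

lemma dist_le_arc_length:
  assumes "a \<le> b"
  shows "ennreal (dist (\<gamma> a) (\<gamma> b)) \<le> arc_length \<gamma> a b"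
  using arc_length_upper[of 1 "\<lambda>i. if i = 0 then a else b" a b \<gamma>] assms
  by (simp add: mono_on_def image_subset_iff)

text \<open>Listing a partition of \<open>{a..b}\<close> and then one of \<open>{b..c}\<close> gives
  a partition of \<open>{a..c}\<close> whose sum is at least the two sums together; suprema are then
  taken one variable at a time.\<close>

lemma arc_length_concat:
  assumes "a \<le> b" "b \<le> c"
  shows "arc_length \<gamma> a b + arc_length \<gamma> b c \<le> arc_length \<gamma> a c"
proof -
  let ?P = "\<lambda>a b. {(n :: nat, t :: nat \<Rightarrow> real). mono_on {..n} t \<and> t ` {..n} \<subseteq> {a..b}}"
  let ?S = "\<lambda>(n, t). \<Sum>i<n. ennreal (dist (\<gamma> (t i)) (\<gamma> (t (Suc i))))"
  have ne: "?P a b \<noteq> {}" if "a \<le> b" for a b :: real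
    using that by (auto intro!: exI[of _ 0] exI[of _ "\<lambda>_. a"] simp: mono_on_def)
  have le: "?S x + ?S y \<le> arc_length \<gamma> a c" if x: "x \<in> ?P a b" and y: "y \<in> ?P b c" for x y
  proof -
    obtain n t where nt: "x = (n,t)" "mono_on {..n} t" "t ` {..n} \<subseteq> {a..b}" using x by auto
    obtain m u where mu: "y = (m,u)" "mono_on {..m} u" "u ` {..m} \<subseteq> {b..c}" using y by auto
    \<comment> \<open>The shift is \<open>Suc n\<close>, not \<open>n\<close>, because the last
      point of \<open>t\<close> and the first point of \<open>u\<close> need not agree. The
      connecting chord has index \<open>n\<close> and is dropped from the total.\<close>
    define v where "v = (\<lambda>i. if i \<le> n then t i else u (i - Suc n))"
    let ?g = "\<lambda>i. ennreal (dist (\<gamma> (v i)) (\<gamma> (v (Suc i))))"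
    have "?S x = (\<Sum>i<n. ?g i)" unfolding nt by (auto simp: v_def intro!: sum.cong)
    moreover have "?S y = (\<Sum>i\<in>{Suc n..<Suc n + m}. ?g i)" unfolding mu prod.case
      by (rule sum.reindex_bij_witness[of _ "\<lambda>i. i - Suc n" "\<lambda>i. i + Suc n"])
         (auto simp: v_def Suc_diff_le)
    moreover have "(\<Sum>i<n. ?g i) + (\<Sum>i\<in>{Suc n..<Suc n + m}. ?g i)
                   = (\<Sum>i\<in>{..<n} \<union> {Suc n..<Suc n + m}. ?g i)"
      by (rule sum.union_disjoint[symmetric]) auto
    moreover have "\<dots> \<le> (\<Sum>i<Suc n + m. ?g i)" by (rule sum_mono2) auto
    moreover have "\<dots> \<le> arc_length \<gamma> a c"
    proof (rule arc_length_upper)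
      show "mono_on {..Suc n + m} v"
      proof (rule mono_onI)
        fix i j assume ij: "i \<in> {..Suc n + m}" "j \<in> {..Suc n + m}" "i \<le> j"
        consider "j \<le> n" | "i \<le> n" "j > n" | "i > n" by linarith
        then show "v i \<le> v j"
        proof cases
          case 1 then show ?thesis using ij nt(2) by (auto simp: v_def mono_on_def)
        next
          case 2
          then have "t i \<in> {a..b}" using nt(3) by (auto simp: image_subset_iff)
          moreover have "u (j - Suc n) \<in> {b..c}" using 2 ij mu(3) by (auto simp: image_subset_iff)
          ultimately show ?thesis using 2 by (simp add: v_def)
        next
          case 3
          then have "u (i - Suc n) \<le> u (j - Suc n)"
            using ij by (intro mono_onD[OF mu(2)]) auto
          then show ?thesis using 3 ij by (simp add: v_def)
        qed
      qed
      show "v ` {..Suc n + m} \<subseteq> {a..c}"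
      proof clarify
        fix i assume i: "i \<le> Suc n + m"
        show "v i \<in> {a..c}"
        proof (cases "i \<le> n")
          case True then have "t i \<in> {a..b}" using nt(3) by (auto simp: image_subset_iff)
          then show ?thesis using True assms by (simp add: v_def)
        next
          case False
          then have "u (i - Suc n) \<in> {b..c}" using i mu(3) by (auto simp: image_subset_iff)
          then show ?thesis using False assms by (simp add: v_def)
        qed
      qed
    qed
    ultimately show ?thesis by simp
  qed
  have "arc_length \<gamma> a b + arc_length \<gamma> b c = (SUP x\<in>?P a b. ?S x + arc_length \<gamma> b c)"
    unfolding arc_length_def[of \<gamma> a b] by (rule ennreal_SUP_add_left[symmetric]) (rule ne[OF assms(1)])
  also have "\<dots> = (SUP x\<in>?P a b. SUP y\<in>?P b c. ?S x + ?S y)"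
    unfolding arc_length_def[of \<gamma> b c]
    by (rule SUP_cong[OF refl], rule ennreal_SUP_add_right) (rule ne[OF assms(2)])
  also have "\<dots> \<le> arc_length \<gamma> a c"
    by (intro SUP_least le)
  finally show ?thesis .
qed

text \<open>For \<open>a \<le> b\<close> this is the nearest-point projection onto
  \<open>{a..b}\<close>. It restricts a partition to a subinterval without inserting points, and it
  depends continuously on the endpoints.\<close>

definition clip :: "real \<Rightarrow> real \<Rightarrow> real \<Rightarrow> real" where
  "clip a b x = max a (min b x)"

lemma clip_partition_le_arc_length:
  assumes "a \<le> b" "mono_on {..n} t"
  shows "(\<Sum>i<n. ennreal (dist (\<gamma> (clip a b (t i))) (\<gamma> (clip a b (t (Suc i)))))) \<le> arc_length \<gamma> a b"
proof -
  have "mono_on {..n} (\<lambda>i. clip a b (t i))"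
  proof (rule mono_onI)
    fix i j assume "i \<in> {..n}" "j \<in> {..n}" "i \<le> j"
    then have "t i \<le> t j" using assms(2) by (auto simp: mono_on_def)
    then show "clip a b (t i) \<le> clip a b (t j)" by (auto simp: clip_def)
  qed
  then show ?thesis using assms(1) by (intro arc_length_upper) (auto simp: clip_def)
qed

text \<open>The remaining inequality projects a partition of \<open>{a..c}\<close> onto both halves
  with \<open>clip\<close>. Only the step straddling \<open>b\<close> needs the triangle inequality;
  any other step survives in one half.\<close>

lemma arc_length_add:
  assumes "a \<le> b" "b \<le> c"
  shows "arc_length \<gamma> a b + arc_length \<gamma> b c = arc_length \<gamma> a c"
proof (rule antisym[OF arc_length_concat[OF assms]], rule arc_length_least)
  fix n and t :: "nat \<Rightarrow> real" assume t: "mono_on {..n} t" "t ` {..n} \<subseteq> {a..c}"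
  have "(\<Sum>i<n. ennreal (dist (\<gamma> (t i)) (\<gamma> (t (Suc i))))) \<le>
        (\<Sum>i<n. ennreal (dist (\<gamma> (clip a b (t i))) (\<gamma> (clip a b (t (Suc i)))))
              + ennreal (dist (\<gamma> (clip b c (t i))) (\<gamma> (clip b c (t (Suc i))))))"
  proof (rule sum_mono)
    fix i assume i: "i \<in> {..<n}"
    then have tt: "t i \<in> {a..c}" "t (Suc i) \<in> {a..c}" "t i \<le> t (Suc i)"
      using t by (auto simp: mono_on_def image_subset_iff)
    consider "t (Suc i) \<le> b" | "t i \<ge> b" | "t i \<le> b" "b \<le> t (Suc i)" by linarith
    then show "ennreal (dist (\<gamma> (t i)) (\<gamma> (t (Suc i)))) \<le>
        ennreal (dist (\<gamma> (clip a b (t i))) (\<gamma> (clip a b (t (Suc i)))))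
              + ennreal (dist (\<gamma> (clip b c (t i))) (\<gamma> (clip b c (t (Suc i)))))"
    proof cases
      case 3
      then have "clip a b (t i) = t i" "clip a b (t (Suc i)) = b"
                "clip b c (t i) = b" "clip b c (t (Suc i)) = t (Suc i)"
        using tt assms by (auto simp: clip_def)
      then show ?thesis
        by (simp add: ennreal_plus[symmetric] dist_triangle del: ennreal_plus)
    next
      case 1
      then have "clip a b (t i) = t i" "clip a b (t (Suc i)) = t (Suc i)"
        using tt assms by (auto simp: clip_def)
      then show ?thesis by simp
    next
      case 2
      then have "clip b c (t i) = t i" "clip b c (t (Suc i)) = t (Suc i)"
        using tt assms by (auto simp: clip_def)
      then show ?thesis by simp
    qed
  qed
  also have "\<dots> \<le> arc_length \<gamma> a b + arc_length \<gamma> b c"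
    unfolding sum.distrib
    by (intro add_mono clip_partition_le_arc_length assms t)
  finally show "(\<Sum>i<n. ennreal (dist (\<gamma> (t i)) (\<gamma> (t (Suc i))))) \<le> arc_length \<gamma> a b + arc_length \<gamma> b c" .
qed

text \<open>A partition with sum above \<open>c\<close> at \<open>t0\<close> is kept and clipped to
  the moving interval from \<open>p t\<close> to \<open>q t\<close>. The clipped sum is continuous
  in \<open>t\<close>, unchanged at \<open>t0\<close>, and bounds the arc length at \<open>t\<close>
  from below. Two moving endpoints cover both the arcs from 0 to \<open>t\<close> and the arcs from
  \<open>t\<close> to 1.\<close>

lemma arc_length_lower_semicontinuous:
  assumes \<gamma>: "continuous_on {0..1} \<gamma>"
    and pq: "continuous_on {0..1} p" "continuous_on {0..1} q"
    and le: "\<And>t. t \<in> {0..1} \<Longrightarrow> 0 \<le> p t \<and> p t \<le> q t \<and> q t \<le> 1"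
    and t0: "t0 \<in> {0..1}" and c: "c < arc_length \<gamma> (p t0) (q t0)"
  shows "\<forall>\<^sub>F t in at t0 within {0..1}. c < arc_length \<gamma> (p t) (q t)"
proof -
  obtain n \<tau> where \<tau>: "mono_on {..n} \<tau>" "\<tau> ` {..n} \<subseteq> {p t0..q t0}"
    "c < (\<Sum>i<n. ennreal (dist (\<gamma> (\<tau> i)) (\<gamma> (\<tau> (Suc i)))))"
    using c unfolding arc_length_def less_SUP_iff by auto
  define F where
    "F t = (\<Sum>i<n. ennreal (dist (\<gamma> (clip (p t) (q t) (\<tau> i))) (\<gamma> (clip (p t) (q t) (\<tau> (Suc i))))))" for t
  have "continuous_on {0..1} (\<lambda>t. \<gamma> (clip (p t) (q t) x))" for x
    by (rule continuous_on_compose2[OF \<gamma>])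
       (use le pq in \<open>force simp: clip_def intro!: continuous_intros\<close>)+
  then have "continuous_on {0..1} F"
    unfolding F_def by (intro continuous_intros continuous_on_ennreal)
  then have "(F \<longlongrightarrow> F t0) (at t0 within {0..1})"
    using t0 by (auto simp: continuous_on_def)
  moreover have "clip (p t0) (q t0) (\<tau> i) = \<tau> i" if "i \<le> n" for i
  proof -
    have "\<tau> i \<in> {p t0..q t0}" using \<tau>(2) that by (auto simp: image_subset_iff)
    then show ?thesis by (auto simp: clip_def)
  qed
  then have "F t0 = (\<Sum>i<n. ennreal (dist (\<gamma> (\<tau> i)) (\<gamma> (\<tau> (Suc i)))))"
    unfolding F_def by (intro sum.cong) auto
  ultimately have "\<forall>\<^sub>F t in at t0 within {0..1}. c < F t"
    using \<tau>(3) by (auto dest: order_tendstoD(1))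
  moreover have "\<forall>\<^sub>F t in at t0 within {0..1}. t \<in> {0..1}"
    by (simp add: eventually_at_filter)
  ultimately show ?thesis
  proof eventually_elim
    case (elim t)
    then have "F t \<le> arc_length \<gamma> (p t) (q t)"
      unfolding F_def using le by (intro clip_partition_le_arc_length \<tau>) auto
    then show ?case using elim by simp
  qed
qed

text \<open>Both \<open>t \<mapsto> arc_length \<gamma> 0 t\<close> and \<open>t \<mapsto> arc_length \<gamma> t 1\<close> are lower semicontinuous, and
  their sum is constant.\<close>

lemma continuous_on_arc_length:
  assumes "path \<gamma>" "rectifiable \<gamma>"
  shows "continuous_on {0..1} (\<lambda>t. enn2real (arc_length \<gamma> 0 t))"
  unfolding continuous_on_def
proof
  fix t0 :: real assume t0: "t0 \<in> {0..1}"
  have \<gamma>: "continuous_on {0..1} \<gamma>" using assms(1) by (simp add: path_def)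
  have fin: "arc_length \<gamma> a b < \<infinity>" if "0 \<le> a" "b \<le> 1" for a b
    using assms(2) arc_length_mono[OF that, of \<gamma>] by (simp add: rectifiable_def)
  have sum: "enn2real (arc_length \<gamma> 0 t) + enn2real (arc_length \<gamma> t 1) = enn2real (arc_length \<gamma> 0 1)"
    if "t \<in> {0..1}" for t
    using that fin by (subst enn2real_plus[symmetric]) (auto simp: arc_length_add)
  have lsc: "\<forall>\<^sub>F t in at t0 within {0..1}. c < enn2real (arc_length \<gamma> (p t) (q t))"
    if c: "c < enn2real (arc_length \<gamma> (p t0) (q t0))"
     and pq: "continuous_on {0..1} p" "continuous_on {0..1} q"
       "\<And>t. t \<in> {0..1} \<Longrightarrow> 0 \<le> p t \<and> p t \<le> q t \<and> q t \<le> 1" for c p q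
  \<comment> \<open>\<open>ennreal\<close> sends negative reals to 0, so a negative \<open>c\<close>
    would not survive the passage to extended values; there the claim is trivial.\<close>
  proof (cases "c < 0")
    case True
    then show ?thesis by (intro always_eventually allI) (meson enn2real_nonneg order_less_le_trans)
  next
    case False
    have ev: "\<forall>\<^sub>F t in at t0 within {0..1}. t \<in> {0..1}"
      by (simp add: eventually_at_filter)
    have c': "ennreal c < arc_length \<gamma> (p t0) (q t0)"
      using False c fin[of "p t0" "q t0"] pq(3)[OF t0]
      by (metis ennreal_enn2real ennreal_less_iff infinity_ennreal_def linorder_not_less)
    have "\<forall>\<^sub>F t in at t0 within {0..1}. ennreal c < arc_length \<gamma> (p t) (q t)"
      by (rule arc_length_lower_semicontinuous[OF \<gamma> pq(1,2) _ t0 c']) (rule pq(3))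
    with ev show ?thesis
    proof eventually_elim
      case (elim t)
      then show ?case using False fin[of "p t" "q t"] pq(3)[OF elim(1)]
        by (metis ennreal_enn2real ennreal_less_iff infinity_ennreal_def linorder_not_less)
    qed
  qed
  show "((\<lambda>t. enn2real (arc_length \<gamma> 0 t)) \<longlongrightarrow> enn2real (arc_length \<gamma> 0 t0)) (at t0 within {0..1})"
  proof (rule order_tendstoI)
    fix c assume "c < enn2real (arc_length \<gamma> 0 t0)"
    then show "\<forall>\<^sub>F t in at t0 within {0..1}. c < enn2real (arc_length \<gamma> 0 t)"
      by (intro lsc) auto
  next
    fix c assume "enn2real (arc_length \<gamma> 0 t0) < c"
    then have "enn2real (arc_length \<gamma> 0 1) - c < enn2real (arc_length \<gamma> t0 1)"
      using sum[OF t0] by simp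
    then have "\<forall>\<^sub>F t in at t0 within {0..1}. enn2real (arc_length \<gamma> 0 1) - c < enn2real (arc_length \<gamma> t 1)"
      by (intro lsc) auto
    moreover have "\<forall>\<^sub>F t in at t0 within {0..1}. t \<in> {0..1}"
      by (simp add: eventually_at_filter)
    ultimately show "\<forall>\<^sub>F t in at t0 within {0..1}. enn2real (arc_length \<gamma> 0 t) < c"
      by eventually_elim (use sum in force)
  qed
qed

section \<open>The normal representation of a rectifiable path\<close>

lemma arc_length_refl: "arc_length \<gamma> a a = 0"
proof -
  have "arc_length \<gamma> a a \<le> 0"
  proof (rule arc_length_least)
    fix n and t :: "nat \<Rightarrow> real" assume "t ` {..n} \<subseteq> {a..a}"
    then have "t i = a" if "i \<le> n" for i using that by auto
    then show "(\<Sum>i<n. ennreal (dist (\<gamma> (t i)) (\<gamma> (t (Suc i))))) \<le> 0" by simp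
  qed
  then show ?thesis by simp
qed

text \<open>By additivity the difference of arc lengths is the length of the arc in between, which
  dominates its chord. Hence arc length determines the point, and the normal representation is
  1-Lipschitz.\<close>

lemma dist_le_arc_length_diff:
  assumes "path \<gamma>" "rectifiable \<gamma>" "t \<in> {0..1}" "t' \<in> {0..1}"
  shows "dist (\<gamma> t) (\<gamma> t') \<le> \<bar>enn2real (arc_length \<gamma> 0 t) - enn2real (arc_length \<gamma> 0 t')\<bar>"
proof -
  have fin: "arc_length \<gamma> a b < \<infinity>" if "0 \<le> a" "b \<le> 1" for a b
    using assms(2) arc_length_mono[OF that, of \<gamma>] by (simp add: rectifiable_def)
  have *: "dist (\<gamma> t) (\<gamma> t') \<le> enn2real (arc_length \<gamma> 0 t') - enn2real (arc_length \<gamma> 0 t)"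
    if "0 \<le> t" "t \<le> t'" "t' \<le> 1" for t t'
  proof -
    have "enn2real (arc_length \<gamma> 0 t') = enn2real (arc_length \<gamma> 0 t) + enn2real (arc_length \<gamma> t t')"
      using that fin by (subst enn2real_plus[symmetric]) (auto simp: arc_length_add)
    moreover have "dist (\<gamma> t) (\<gamma> t') \<le> enn2real (arc_length \<gamma> t t')"
      using dist_le_arc_length[OF that(2), of \<gamma>] fin[of t t'] that
      by (metis enn2real_ennreal enn2real_mono infinity_ennreal_def zero_le_dist)
    ultimately show ?thesis by simp
  qed
  show ?thesis
  proof (cases "t \<le> t'")
    case True then show ?thesis using *[of t t'] assms by auto
  next
    case False then show ?thesis using *[of t' t] assms by (auto simp: dist_commute)
  qed
qed

text \<open>The definite description is legitimate because parameters with equal arc length have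
  equal images, as the chord bound shows.\<close>

lemma normal_rep_arc_length:
  assumes "path \<gamma>" "rectifiable \<gamma>" "t \<in> {0..1}"
  shows "normal_rep \<gamma> (enn2real (arc_length \<gamma> 0 t)) = \<gamma> t"
  unfolding normal_rep_def
proof (rule the_equality)
  have "arc_length \<gamma> 0 t < \<infinity>"
    using assms arc_length_mono[of 0 0 t 1 \<gamma>] by (auto simp: rectifiable_def)
  then show "\<exists>t'\<in>{0..1}. arc_length \<gamma> 0 t' = ennreal (enn2real (arc_length \<gamma> 0 t)) \<and> \<gamma> t' = \<gamma> t"
    using assms(3) by (intro bexI[of _ t]) auto
next
  fix x assume "\<exists>t'\<in>{0..1}. arc_length \<gamma> 0 t' = ennreal (enn2real (arc_length \<gamma> 0 t)) \<and> \<gamma> t' = x"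
  then show "x = \<gamma> t" using dist_le_arc_length_diff[OF assms(1,2) _ assms(3)] by fastforce
qed

lemma arc_length_attains:
  assumes "path \<gamma>" "rectifiable \<gamma>" "s \<in> {0..enn2real (arc_length \<gamma> 0 1)}"
  obtains t where "t \<in> {0..1}" "enn2real (arc_length \<gamma> 0 t) = s"
  using IVT'[OF _ _ _ continuous_on_arc_length[OF assms(1,2)], of s] assms(3)
  by (auto simp: arc_length_refl)

lemma dist_normal_rep_le:
  assumes "path \<gamma>" "rectifiable \<gamma>"
    and s: "s \<in> {0..enn2real (arc_length \<gamma> 0 1)}" and s': "s' \<in> {0..enn2real (arc_length \<gamma> 0 1)}"
  shows "dist (normal_rep \<gamma> s) (normal_rep \<gamma> s') \<le> \<bar>s - s'\<bar>"
proof -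
  obtain t where t: "t \<in> {0..1}" "enn2real (arc_length \<gamma> 0 t) = s"
    using arc_length_attains[OF assms(1,2) s] .
  obtain t' where t': "t' \<in> {0..1}" "enn2real (arc_length \<gamma> 0 t') = s'"
    using arc_length_attains[OF assms(1,2) s'] .
  show ?thesis
    using dist_le_arc_length_diff[OF assms(1,2) t(1) t'(1)] t t' normal_rep_arc_length[OF assms(1,2)]
    by auto
qed

lemma normal_rep_attains:
  assumes "path \<gamma>" "rectifiable \<gamma>" "x \<in> path_image \<gamma>"
  obtains s where "s \<in> {0..enn2real (arc_length \<gamma> 0 1)}" "normal_rep \<gamma> s = x"
proof -
  obtain t where t: "t \<in> {0..1}" "\<gamma> t = x" using assms(3) by (auto simp: path_image_def)
  have "arc_length \<gamma> 0 t \<le> arc_length \<gamma> 0 1" using t by (intro arc_length_mono) auto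
  then have "enn2real (arc_length \<gamma> 0 t) \<in> {0..enn2real (arc_length \<gamma> 0 1)}"
    using assms(2) by (auto simp: rectifiable_def intro: enn2real_mono)
  then show ?thesis using that normal_rep_arc_length[OF assms(1,2) t(1)] t(2) by blast
qed

text \<open>Paths are total functions on the reals, but only parameters in the unit interval count.
  This identifies a path with its round trip through a homeomorphism and its inverse, which may
  differ elsewhere.\<close>

lemma line_integral_cong:
  assumes "\<And>t. t \<in> {0..1} \<Longrightarrow> \<gamma> t = \<gamma>' t"
  shows "line_integral \<gamma> \<rho> = line_integral \<gamma>' \<rho>"
proof -
  have l: "arc_length \<gamma> 0 t = arc_length \<gamma>' 0 t" if "t \<in> {0..1}" for t
    using that assms by (intro arc_length_cong) auto
  have "normal_rep \<gamma> s = normal_rep \<gamma>' s" for s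
    unfolding normal_rep_def by (rule arg_cong[where f=The]) (use l assms in auto)
  then show ?thesis using l[of 1] by (simp add: line_integral_def rectifiable_def)
qed


subsection \<open>Line integrals of radial step functions\<close>

text \<open>Take a closest pair of points of the closed sets where \<open>u \<le> lo\<close> and
  where \<open>hi \<le> u\<close>. Nothing strictly between them lies in either set, and the
  Lipschitz bound makes the gap at least \<open>hi - lo\<close>.\<close>

lemma one_lipschitz_crossing:
  fixes u :: "real \<Rightarrow> real"
  assumes lip: "\<And>s s'. s \<in> {0..L} \<Longrightarrow> s' \<in> {0..L} \<Longrightarrow> \<bar>u s - u s'\<bar> \<le> \<bar>s - s'\<bar>"
    and s1: "s1 \<in> {0..L}" "u s1 \<le> lo" and s2: "s2 \<in> {0..L}" "hi \<le> u s2"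
  obtains p q where "p \<le> q" "{p<..<q} \<subseteq> {0..L}" "hi - lo \<le> q - p"
    "\<And>s. s \<in> {p<..<q} \<Longrightarrow> lo < u s \<and> u s < hi"
proof -
  have u: "continuous_on {0..L} u"
    unfolding continuous_on_iff
  proof (intro ballI allI impI)
    fix s and e :: real assume s: "s \<in> {0..L}" "0 < e"
    have "dist (u s') (u s) < e" if "s' \<in> {0..L}" "dist s' s < e" for s'
      using lip[OF that(1) s(1)] that(2) by (simp add: dist_real_def)
    then show "\<exists>d>0. \<forall>s'\<in>{0..L}. dist s' s < d \<longrightarrow> dist (u s') (u s) < e" using s(2) by blast
  qed
  define S1 where "S1 = {s\<in>{0..L}. u s \<le> lo}"
  define S2 where "S2 = {s\<in>{0..L}. hi \<le> u s}"
  have "closed S1" unfolding S1_def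
    by (rule continuous_on_closed_Collect_le[OF u continuous_on_const closed_atLeastAtMost])
  moreover have "closed S2" unfolding S2_def
    by (rule continuous_on_closed_Collect_le[OF continuous_on_const u closed_atLeastAtMost])
  moreover have "bounded S1" "bounded S2"
    unfolding S1_def S2_def by (rule bounded_subset[OF bounded_closed_interval[of 0 L]], blast)+
  ultimately have "compact (S1 \<times> S2)" by (intro compact_Times) (auto simp: compact_eq_bounded_closed)
  moreover have "S1 \<times> S2 \<noteq> {}" using s1 s2 by (auto simp: S1_def S2_def)
  moreover have "continuous_on (S1 \<times> S2) (\<lambda>x. \<bar>fst x - snd x\<bar>)" by (intro continuous_intros)
  ultimately have "\<exists>z\<in>S1 \<times> S2. \<forall>y\<in>S1 \<times> S2. \<bar>fst z - snd z\<bar> \<le> \<bar>fst y - snd y\<bar>"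
    by (rule continuous_attains_inf)
  then obtain z where z: "z \<in> S1 \<times> S2" "\<And>y. y \<in> S1 \<times> S2 \<Longrightarrow> \<bar>fst z - snd z\<bar> \<le> \<bar>fst y - snd y\<bar>"
    by blast
  obtain a b where ab: "a \<in> S1" "b \<in> S2" "z = (a,b)" using z(1) by auto
  have min: "\<bar>a - b\<bar> \<le> \<bar>x - y\<bar>" if "x \<in> S1" "y \<in> S2" for x y
    using z(2)[of "(x,y)"] that ab(3) by auto
  \<comment> \<open>The closest point of \<open>S1\<close> may lie on either side of that of
    \<open>S2\<close>, hence \<open>min\<close> and \<open>max\<close>.\<close>
  show ?thesis
  proof (rule that[of "min a b" "max a b"])
    show "hi - lo \<le> max a b - min a b" using lip[of b a] ab by (auto simp: S1_def S2_def)
    show "{min a b<..<max a b} \<subseteq> {0..L}" using ab by (auto simp: S1_def S2_def)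
    fix s assume s: "s \<in> {min a b<..<max a b}"
    then have "s \<in> {0..L}" using ab by (auto simp: S1_def S2_def)
    moreover have "s \<notin> S1" using min[of s b] ab s by auto
    moreover have "s \<notin> S2" using min[of a s] ab s by auto
    ultimately show "lo < u s \<and> u s < hi" by (auto simp: S1_def S2_def)
  qed auto
qed

text \<open>In arc length parameter the distance to \<open>x0\<close> is 1-Lipschitz, so the path
  spends length at least \<open>hi k - lo k\<close> in each annulus. The comparison functions are
  indicators of parameter intervals, hence measurable; the composition with
  \<open>normal_rep\<close> appears only as the upper bound.\<close>

lemma line_integral_radial_step_ge:
  fixes x0 :: "'a::metric_space"
  assumes "path \<gamma>" and x: "x \<in> path_image \<gamma>" and y: "y \<in> path_image \<gamma>"
    and fin: "finite K"
    and K: "\<And>k. k \<in> K \<Longrightarrow> dist x0 x \<le> lo k \<and> lo k \<le> hi k \<and> hi k \<le> dist x0 y"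
    and c: "\<And>k. k \<in> K \<Longrightarrow> 0 \<le> c k"
  shows "ennreal (\<Sum>k\<in>K. c k * (hi k - lo k)) \<le>
    line_integral \<gamma> (\<lambda>x. \<Sum>k\<in>K. ennreal (c k) * indicator {x. lo k \<le> dist x0 x \<and> dist x0 x < hi k} x)"
proof (cases "rectifiable \<gamma>")
  case True
  define L where "L = enn2real (arc_length \<gamma> 0 1)"
  define u where "u s = dist x0 (normal_rep \<gamma> s)" for s
  have lip: "\<bar>u s - u s'\<bar> \<le> \<bar>s - s'\<bar>" if "s \<in> {0..L}" "s' \<in> {0..L}" for s s'
    using dist_normal_rep_le[OF assms(1) True, of s s'] that
      abs_dist_diff_le[of "normal_rep \<gamma> s" x0 "normal_rep \<gamma> s'"]
    unfolding u_def L_def by (simp add: dist_commute)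
  obtain s1 where s1: "s1 \<in> {0..L}" "u s1 = dist x0 x"
    using normal_rep_attains[OF assms(1) True x] unfolding u_def L_def by metis
  obtain s2 where s2: "s2 \<in> {0..L}" "u s2 = dist x0 y"
    using normal_rep_attains[OF assms(1) True y] unfolding u_def L_def by metis
  have "\<exists>p q. p \<le> q \<and> {p<..<q} \<subseteq> {0..L} \<and> hi k - lo k \<le> q - p \<and>
         (\<forall>s\<in>{p<..<q}. lo k < u s \<and> u s < hi k)" if "k \<in> K" for k
    using one_lipschitz_crossing[of L u s1 "lo k" s2 "hi k", OF lip] s1 s2 K[OF that] by metis
  then obtain p q where pq: "\<And>k. k \<in> K \<Longrightarrow> p k \<le> q k" "\<And>k. k \<in> K \<Longrightarrow> {p k<..<q k} \<subseteq> {0..L}"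
    "\<And>k. k \<in> K \<Longrightarrow> hi k - lo k \<le> q k - p k"
    "\<And>k s. k \<in> K \<Longrightarrow> s \<in> {p k<..<q k} \<Longrightarrow> lo k < u s \<and> u s < hi k"
    by metis
  have "ennreal (\<Sum>k\<in>K. c k * (hi k - lo k)) \<le> ennreal (\<Sum>k\<in>K. c k * (q k - p k))"
    by (intro ennreal_leI sum_mono mult_left_mono pq c)
  also have "\<dots> = (\<Sum>k\<in>K. ennreal (c k) * ennreal (q k - p k))"
    using c pq(1) by (subst sum_ennreal[symmetric]) (auto intro!: sum.cong simp: ennreal_mult)
  also have "\<dots> = (\<Sum>k\<in>K. \<integral>\<^sup>+ s. ennreal (c k) * indicator {p k<..<q k} s \<partial>lborel)"
    using pq(1) by (intro sum.cong) (auto simp: nn_integral_cmult_indicator)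
  also have "\<dots> = (\<integral>\<^sup>+ s. (\<Sum>k\<in>K. ennreal (c k) * indicator {p k<..<q k} s) \<partial>lborel)"
    by (rule nn_integral_sum[symmetric]) auto
  also have "\<dots> \<le> (\<integral>\<^sup>+ s \<in> {0..L}. (\<Sum>k\<in>K. ennreal (c k) *
       indicator {x. lo k \<le> dist x0 x \<and> dist x0 x < hi k} (normal_rep \<gamma> s)) \<partial>lborel)"
  proof (rule nn_integral_mono)
    fix s :: real
    show "(\<Sum>k\<in>K. ennreal (c k) * indicator {p k<..<q k} s) \<le> (\<Sum>k\<in>K. ennreal (c k) *
       indicator {x. lo k \<le> dist x0 x \<and> dist x0 x < hi k} (normal_rep \<gamma> s)) * indicator {0..L} s"
      unfolding sum_distrib_right
    proof (rule sum_mono)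
      fix k assume k: "k \<in> K"
      show "ennreal (c k) * indicator {p k<..<q k} s \<le> ennreal (c k) *
       indicator {x. lo k \<le> dist x0 x \<and> dist x0 x < hi k} (normal_rep \<gamma> s) * indicator {0..L} s"
        using pq(2)[OF k] pq(4)[OF k, of s]
        by (auto simp: indicator_def u_def less_imp_le)
    qed
  qed
  finally show ?thesis using True by (simp add: line_integral_def L_def)
qed (simp add: line_integral_def)


subsection \<open>Energy of radial step functions\<close>

text \<open>The annuli are half-open so that adjacent ones are disjoint. The index type is
  arbitrary: dyadic levels serve for the logarithmic density, the unit type for a single
  annulus.\<close>

definition radial_step :: "'a::metric_space \<Rightarrow> 'k set \<Rightarrow> ('k \<Rightarrow> real) \<Rightarrow> ('k \<Rightarrow> real) \<Rightarrow> ('k \<Rightarrow> real) \<Rightarrow> 'a \<Rightarrow> ennreal"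
  where "radial_step x0 K lo hi c x =
    (\<Sum>k\<in>K. ennreal (c k) * indicator {x. lo k \<le> dist x0 x \<and> dist x0 x < hi k} x)"

lemma annulus_borel [measurable]: "{x::'a::metric_space. lo \<le> dist x0 x \<and> dist x0 x < hi} \<in> sets borel"
proof -
  have "{x. lo \<le> dist x0 x \<and> dist x0 x < hi} = {x. lo \<le> dist x0 x} \<inter> {x. dist x0 x < hi}" by auto
  moreover have "closed {x. lo \<le> dist x0 x}" "open {x. dist x0 x < hi}"
    by (intro closed_Collect_le open_Collect_less continuous_intros)+
  ultimately show ?thesis by auto
qed

lemma radial_step_admissible:
  assumes "finite K" "1 \<le> (\<Sum>k\<in>K. c k * (hi k - lo k))"
    and "\<And>k. k \<in> K \<Longrightarrow> lo k \<le> hi k" "\<And>k. k \<in> K \<Longrightarrow> 0 \<le> c k"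
    and "\<And>\<gamma>. \<gamma> \<in> \<Gamma> \<Longrightarrow> path \<gamma>"
    and "\<And>\<gamma>. \<gamma> \<in> \<Gamma> \<Longrightarrow> \<exists>x\<in>path_image \<gamma>. \<forall>k\<in>K. dist x0 x \<le> lo k"
    and "\<And>\<gamma>. \<gamma> \<in> \<Gamma> \<Longrightarrow> \<exists>y\<in>path_image \<gamma>. \<forall>k\<in>K. hi k \<le> dist x0 y"
  shows "radial_step x0 K lo hi c \<in> admissible \<Gamma>"
  unfolding admissible_def
proof (intro CollectI conjI ballI)
  show "radial_step x0 K lo hi c \<in> borel_measurable borel"
    unfolding radial_step_def by measurable
  fix \<gamma> assume \<gamma>: "\<gamma> \<in> \<Gamma>"
  obtain x y where xy: "x \<in> path_image \<gamma>" "y \<in> path_image \<gamma>"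
    "\<And>k. k \<in> K \<Longrightarrow> dist x0 x \<le> lo k" "\<And>k. k \<in> K \<Longrightarrow> hi k \<le> dist x0 y"
    using assms(6,7)[OF \<gamma>] by auto
  have "1 \<le> ennreal (\<Sum>k\<in>K. c k * (hi k - lo k))" using assms(2) by simp
  also have "\<dots> \<le> line_integral \<gamma> (radial_step x0 K lo hi c)"
    unfolding radial_step_def
    by (rule line_integral_radial_step_ge[OF assms(5)[OF \<gamma>] xy(1,2) assms(1)])
       (use assms(3,4) xy(3,4) in auto)
  finally show "1 \<le> line_integral \<gamma> (radial_step x0 K lo hi c)" .
qed

text \<open>Disjointness leaves at most one nonzero summand, so the power acts on the coefficients.
  Off all annuli the value stays 0 since \<open>0 < \<alpha>\<close>; \<open>epowr\<close> gives 1
  at exponent 0.\<close>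

lemma epowr_radial_step:
  assumes "finite K" "0 < \<alpha>" and c: "\<And>k. k \<in> K \<Longrightarrow> 0 \<le> c k"
    and dis: "disjoint_family_on (\<lambda>k. {x. lo k \<le> dist x0 x \<and> dist x0 x < hi k}) K"
  shows "epowr (radial_step x0 K lo hi c x) \<alpha> = radial_step x0 K lo hi (\<lambda>k. c k powr \<alpha>) x"
proof (cases "\<exists>j\<in>K. lo j \<le> dist x0 x \<and> dist x0 x < hi j")
  case True
  then obtain j where j: "j \<in> K" "lo j \<le> dist x0 x" "dist x0 x < hi j" by auto
  have "radial_step x0 K lo hi d x = ennreal (d j)" for d
  proof -
    have "radial_step x0 K lo hi d x = (\<Sum>k\<in>{j}. ennreal (d k) * indicator {x. lo k \<le> dist x0 x \<and> dist x0 x < hi k} x)"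
      unfolding radial_step_def
      by (rule sum.mono_neutral_right)
         (use assms(1) j dis in \<open>auto simp: disjoint_family_on_def indicator_def set_eq_iff\<close>)
    then show ?thesis using j by simp
  qed
  then show ?thesis using c[OF j(1)] assms(2) by (simp add: epowr_def)
next
  case False
  then have "radial_step x0 K lo hi d x = 0" for d
    unfolding radial_step_def by (intro sum.neutral) (auto simp: indicator_def)
  then show ?thesis using assms(2) by (simp add: epowr_def)
qed

text \<open>\<open>Q\<close> is measurable with respect to the completion of \<open>\<mu>\<close>,
  so the integral is moved there, where additivity applies, and then moved back.\<close>

lemma nn_integral_radial_step:
  assumes "sets \<mu> = sets borel" "open D" "measurable_on_domain \<mu> D Q"
    and fin: "finite K" and "0 < \<alpha>" and c: "\<And>k. k \<in> K \<Longrightarrow> 0 \<le> c k"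
    and dis: "disjoint_family_on (\<lambda>k. {x. lo k \<le> dist x0 x \<and> dist x0 x < hi k}) K"
  shows "(\<integral>\<^sup>+x\<in>D. Q x * epowr (radial_step x0 K lo hi c x) \<alpha> \<partial>\<mu>)
    = (\<Sum>k\<in>K. ennreal (c k powr \<alpha>) * (\<integral>\<^sup>+x\<in>D \<inter> {x. lo k \<le> dist x0 x \<and> dist x0 x < hi k}. Q x \<partial>\<mu>))"
proof -
  define A where "A k = {x. lo k \<le> dist x0 x \<and> dist x0 x < hi k}" for k
  have sets: "A k \<in> sets (completion \<mu>)" for k
    unfolding A_def using assms(1) annulus_borel by (intro sets_completionI_sets) auto
  have D: "D \<in> sets \<mu>" using assms(1,2) by auto
  then have QD: "(\<lambda>x. Q x * indicator D x) \<in> borel_measurable (completion \<mu>)"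
    using assms(3) unfolding measurable_on_domain_def
    by (subst (asm) borel_measurable_restrict_space_iff_ennreal) (auto simp: sets_completionI_sets)
  have QA: "(\<lambda>x. Q x * indicator D x * indicator (A k) x) \<in> borel_measurable (completion \<mu>)" for k
    using sets[of k] by (intro borel_measurable_times_ennreal QD borel_measurable_indicator)
  have ep: "epowr (radial_step x0 K lo hi c x) \<alpha> = radial_step x0 K lo hi (\<lambda>k. c k powr \<alpha>) x" for x
    by (rule epowr_radial_step[OF fin assms(5) _ dis]) (rule c)
  have "(\<integral>\<^sup>+x\<in>D. Q x * epowr (radial_step x0 K lo hi c x) \<alpha> \<partial>\<mu>)
      = (\<integral>\<^sup>+x. (\<Sum>k\<in>K. ennreal (c k powr \<alpha>) * (Q x * indicator D x * indicator (A k) x)) \<partial>completion \<mu>)"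
    unfolding nn_integral_completion ep
    by (intro nn_integral_cong) (simp add: radial_step_def A_def sum_distrib_left sum_distrib_right ac_simps)
  also have "\<dots> = (\<Sum>k\<in>K. ennreal (c k powr \<alpha>) * (\<integral>\<^sup>+x. Q x * indicator D x * indicator (A k) x \<partial>completion \<mu>))"
    using QA by (subst nn_integral_sum) (auto intro!: sum.cong nn_integral_cmult)
  also have "\<dots> = (\<Sum>k\<in>K. ennreal (c k powr \<alpha>) * (\<integral>\<^sup>+x\<in>D \<inter> A k. Q x \<partial>\<mu>))"
    unfolding nn_integral_completion by (simp add: indicator_inter_arith ac_simps)
  finally show ?thesis unfolding A_def .
qed

lemma nn_integral_annulus:
  assumes "sets \<mu> = sets borel" "open D" "measurable_on_domain \<mu> D Q" "0 < \<alpha>" "0 \<le> c"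
  shows "(\<integral>\<^sup>+x\<in>D. Q x * epowr (radial_step x0 {()} (\<lambda>_. lo) (\<lambda>_. hi) (\<lambda>_. c) x) \<alpha> \<partial>\<mu>)
    = ennreal (c powr \<alpha>) * (\<integral>\<^sup>+x\<in>D \<inter> {x. lo \<le> dist x0 x \<and> dist x0 x < hi}. Q x \<partial>\<mu>)"
  by (subst nn_integral_radial_step[OF assms(1-3)]) (use assms in \<open>auto simp: disjoint_family_on_def\<close>)

section \<open>The logarithmic density\<close>

text \<open>The coefficient of level \<open>k\<close> times its outer radius is
  \<open>2 / (k * S)\<close>, and the logarithm at that radius is \<open>k * ln 2\<close>, at most
  \<open>k * S\<close>. So the powers of \<open>k * S\<close> reduce to exponent -1, and the two
  factors \<open>2 powr \<alpha>\<close> cancel.\<close>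

lemma log_weight_bound:
  fixes k :: nat and S \<alpha> :: real
  assumes "1 \<le> k" "1 \<le> S" "1 \<le> \<alpha>"
  shows "(2 ^ (k+1) / (k * S)) powr \<alpha> *
     ((1 / 2 ^ k) powr \<alpha> * ln (1 / (1 / 2 ^ k)) powr (\<alpha> - 1) / (2 * 2 powr \<alpha>)) \<le> 1 / (2 * (k * S))"
proof -
  have kS: "0 < k * S" using assms by simp
  have "(2 ^ (k+1) / (k * S)) powr \<alpha> * (1 / 2 ^ k) powr \<alpha> = (2 / (k * S)) powr \<alpha>"
    using assms by (simp add: powr_mult[symmetric] field_simps)
  also have "\<dots> = 2 powr \<alpha> / (k * S) powr \<alpha>"
    using assms by (simp add: powr_divide)
  also have "\<dots> = 2 powr \<alpha> / ((k * S) * (k * S) powr (\<alpha> - 1))"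
    using kS by (simp add: powr_mult_base)
  finally have eq: "(2 ^ (k+1) / (k * S)) powr \<alpha> * (1 / 2 ^ k) powr \<alpha> =
    2 powr \<alpha> / ((k * S) * (k * S) powr (\<alpha> - 1))" .
  have "ln (1 / (1 / 2 ^ k)) = k * ln (2::real)" by (simp add: ln_realpow)
  also have "\<dots> \<le> k * S"
    using assms ln_2_less_1 by (intro mult_left_mono) auto
  finally have "ln (1 / (1 / 2 ^ k :: real)) powr (\<alpha> - 1) \<le> (k * S) powr (\<alpha> - 1)"
    using assms by (intro powr_mono2) (auto simp: ln_realpow)
  then have "2 powr \<alpha> / ((k * S) * (k * S) powr (\<alpha> - 1)) * (ln (1 / (1 / 2 ^ k)) powr (\<alpha> - 1) / (2 * 2 powr \<alpha>))
     \<le> 2 powr \<alpha> / ((k * S) * (k * S) powr (\<alpha> - 1)) * ((k * S) powr (\<alpha> - 1) / (2 * 2 powr \<alpha>))"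
    using assms by (intro mult_left_mono divide_right_mono) auto
  also have "\<dots> = 1 / (2 * (k * S))" using kS by (simp add: field_simps)
  finally show ?thesis using eq by (simp add: mult.assoc[symmetric])
qed

text \<open>Bounded means compare the integral with \<open>K\<close> times the measure of the ball
  within \<open>D\<close>, upper regularity compares that measure with
  \<open>C * l \<epsilon>\<close>, and the little-o condition absorbs \<open>K\<close>,
  \<open>C\<close> and \<open>b\<close>.\<close>

lemma nn_integral_ball_bound:
  fixes \<mu> :: "'a::metric_space measure"
  assumes "sets \<mu> = sets borel" "open D" "upper_regular_at \<mu> l x0"
    and lim: "Limsup (at_right 0)
             (\<lambda>\<epsilon>::real. 1 / emeasure \<mu> (ball x0 \<epsilon> \<inter> D) * (\<integral>\<^sup>+ x \<in> ball x0 \<epsilon> \<inter> D. Q x \<partial>\<mu>)) < \<infinity>"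
    and l: "l \<in> o[at_right 0](\<lambda>\<epsilon>. \<epsilon> powr \<alpha> * ln (1 / \<epsilon>) powr (\<alpha> - 1))"
    and "0 < b"
  shows "\<forall>\<^sub>F \<epsilon> in at_right 0. (\<integral>\<^sup>+ x \<in> ball x0 \<epsilon> \<inter> D. Q x \<partial>\<mu>) \<le>
           ennreal (\<epsilon> powr \<alpha> * ln (1 / \<epsilon>) powr (\<alpha> - 1) / b)"
proof -
  obtain K where K: "0 < K" "\<forall>\<^sub>F \<epsilon> in at_right (0::real). 1 / emeasure \<mu> (ball x0 \<epsilon> \<inter> D) *
      (\<integral>\<^sup>+ x \<in> ball x0 \<epsilon> \<inter> D. Q x \<partial>\<mu>) < ennreal K"
  proof -
    obtain z where z: "Limsup (at_right 0)
             (\<lambda>\<epsilon>::real. 1 / emeasure \<mu> (ball x0 \<epsilon> \<inter> D) * (\<integral>\<^sup>+ x \<in> ball x0 \<epsilon> \<inter> D. Q x \<partial>\<mu>)) < z" "z < \<infinity>"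
      using dense[OF lim] by auto
    obtain K where "z = ennreal K" "0 \<le> K" using z(2) by (cases z) auto
    moreover have "z \<noteq> 0" using z(1) by auto
    ultimately show ?thesis using that[of K] Limsup_lessD[OF z(1)] by auto
  qed
  obtain C r0 where C: "0 < C" "0 < r0" "\<And>r. r \<in> {0<..<r0} \<Longrightarrow> 0 \<le> l r"
      "\<And>r. r \<in> {0<..<r0} \<Longrightarrow> emeasure \<mu> (ball x0 r) \<le> ennreal (C * l r)"
    using assms(3) unfolding upper_regular_at_def by auto
  have "\<forall>\<^sub>F \<epsilon> in at_right (0::real). norm (l \<epsilon>) \<le> 1 / (K * C * b) * norm (\<epsilon> powr \<alpha> * ln (1 / \<epsilon>) powr (\<alpha> - 1))"
    using C(1) K(1) assms(6) by (intro landau_o.smallD[OF l]) simp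
  moreover have "\<forall>\<^sub>F \<epsilon> in at_right (0::real). \<epsilon> \<in> {0<..<r0}"
    using C(2) by (rule eventually_at_right_real)
  ultimately show ?thesis using K(2)
  proof eventually_elim
    case (elim \<epsilon>)
    let ?B = "ball x0 \<epsilon> \<inter> D"
    let ?I = "\<integral>\<^sup>+ x \<in> ?B. Q x \<partial>\<mu>"
    have B: "?B \<in> sets \<mu>" "ball x0 \<epsilon> \<in> sets \<mu>" using assms(1,2) by auto
    have m: "emeasure \<mu> ?B \<le> ennreal (C * l \<epsilon>)"
      using C(4)[OF elim(2)] emeasure_mono[OF _ B(2), of ?B] by force
    have "?I \<le> ennreal K * emeasure \<mu> ?B"
    \<comment> \<open>On a null set the integral vanishes; otherwise the measure is finite and
      positive, so it cancels against its reciprocal.\<close>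
    proof (cases "emeasure \<mu> ?B = 0")
      case True
      then show ?thesis using B by (subst nn_integral_null_set) (auto simp: null_sets_def)
    next
      case False
      have fin: "emeasure \<mu> ?B < top" using m by (simp add: le_less_trans)
      have "emeasure \<mu> ?B * (1 / emeasure \<mu> ?B) = 1"
        using False fin by (simp add: ennreal_times_divide ennreal_divide_self)
      then have "?I = emeasure \<mu> ?B * (1 / emeasure \<mu> ?B) * ?I" by simp
      also have "\<dots> = (1 / emeasure \<mu> ?B * ?I) * emeasure \<mu> ?B" by (simp add: ac_simps)
      also have "\<dots> \<le> ennreal K * emeasure \<mu> ?B" using elim(3) by (intro mult_right_mono) auto
      finally show ?thesis .
    qed
    also have "\<dots> \<le> ennreal K * ennreal (C * l \<epsilon>)" by (intro mult_left_mono m) simp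
    also have "\<dots> = ennreal (K * C * l \<epsilon>)" using K(1) C(1) C(3)[OF elim(2)] by (simp add: ennreal_mult' mult.assoc)
    also have "\<dots> \<le> ennreal (\<epsilon> powr \<alpha> * ln (1 / \<epsilon>) powr (\<alpha> - 1) / b)"
    proof (rule ennreal_leI)
      have "K * C * l \<epsilon> \<le> K * C * (1 / (K * C * b) * norm (\<epsilon> powr \<alpha> * ln (1 / \<epsilon>) powr (\<alpha> - 1)))"
        using elim(1) K(1) C(1) by (intro mult_left_mono) auto
      then show "K * C * l \<epsilon> \<le> \<epsilon> powr \<alpha> * ln (1 / \<epsilon>) powr (\<alpha> - 1) / b"
        using K(1) C(1) assms(6) by simp
    qed
    finally show ?case .
  qed
qed

text \<open>The density is a discretization of \<open>1 / (t log (1/t))\<close>: on the annulus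
  \<open>2\<^sup>-\<^sup>(\<^sup>k\<^sup>+\<^sup>1\<^sup>) \<le> t < 2\<^sup>-\<^sup>k\<close> it is \<open>2\<^sup>k\<^sup>+\<^sup>1 / (k S)\<close>, where \<open>S = \<Sum>1/k \<ge> 1\<close> by divergence of the
  harmonic series.\<close>

lemma small_energy_log_density:
  fixes \<mu> :: "'a::metric_space measure"
  assumes "sets \<mu> = sets borel" "open D" "measurable_on_domain \<mu> D Q" "upper_regular_at \<mu> l x0"
    and "Limsup (at_right 0)
             (\<lambda>\<epsilon>::real. 1 / emeasure \<mu> (ball x0 \<epsilon> \<inter> D) * (\<integral>\<^sup>+ x \<in> ball x0 \<epsilon> \<inter> D. Q x \<partial>\<mu>)) < \<infinity>"
    and "l \<in> o[at_right 0](\<lambda>\<epsilon>. \<epsilon> powr \<alpha> * ln (1 / \<epsilon>) powr (\<alpha> - 1))"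
    and "1 \<le> \<alpha>" "0 < R"
  obtains r where "0 < r"
    "\<And>\<Gamma>. (\<And>\<gamma>. \<gamma> \<in> \<Gamma> \<Longrightarrow> path \<gamma> \<and> (\<exists>x\<in>path_image \<gamma>. dist x0 x < r) \<and> (\<exists>y\<in>path_image \<gamma>. R \<le> dist x0 y)) \<Longrightarrow>
       \<exists>\<rho>\<in>admissible \<Gamma>. (\<integral>\<^sup>+x\<in>D. Q x * epowr (\<rho> x) \<alpha> \<partial>\<mu>) < 1"
proof -
  have "\<forall>\<^sub>F \<epsilon> in at_right 0. (\<integral>\<^sup>+ x \<in> ball x0 \<epsilon> \<inter> D. Q x \<partial>\<mu>) \<le>
           ennreal (\<epsilon> powr \<alpha> * ln (1 / \<epsilon>) powr (\<alpha> - 1) / (2 * 2 powr \<alpha>))"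
    by (rule nn_integral_ball_bound[OF assms(1,2,4,5,6)]) simp
  \<comment> \<open>The constant \<open>2 * 2 powr \<alpha>\<close> is the one in
    \<open>log_weight_bound\<close>; it brings the total energy down to 1/2.\<close>
  then obtain \<delta> where \<delta>: "0 < \<delta>" "\<And>\<epsilon>. 0 < \<epsilon> \<Longrightarrow> \<epsilon> < \<delta> \<Longrightarrow> (\<integral>\<^sup>+ x \<in> ball x0 \<epsilon> \<inter> D. Q x \<partial>\<mu>) \<le>
           ennreal (\<epsilon> powr \<alpha> * ln (1 / \<epsilon>) powr (\<alpha> - 1) / (2 * 2 powr \<alpha>))"
    unfolding eventually_at_right_field by auto
  \<comment> \<open>Levels \<open>k\<close> above \<open>m\<close> have outer radius below
    \<open>\<delta>\<close>, where the integral bound holds, and below \<open>R\<close>, which every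
    path in question reaches.\<close>
  obtain m :: nat where "(1/2) ^ m < min \<delta> R"
    using real_arch_pow_inv[of "min \<delta> R" "1/2"] \<delta>(1) assms(8) by auto
  then have m: "1 / 2 ^ m < \<delta>" "1 / 2 ^ m < R" by (auto simp: power_one_over)
  have "\<forall>\<^sub>F n in sequentially. harm m + 1 \<le> (harm n :: real)"
    using harm_at_top by (simp add: filterlim_at_top)
  then obtain N where "\<And>n. N \<le> n \<Longrightarrow> harm m + 1 \<le> (harm n :: real)"
    unfolding eventually_sequentially by auto
  then obtain n where n: "m \<le> n" "harm m + 1 \<le> (harm n :: real)"
    by (meson max.cobounded1 max.cobounded2)
  define K where "K = {m<..n}"
  define S where "S = (\<Sum>k\<in>K. 1 / real k)"
  have "harm n = harm m + S"
  proof -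
    have "harm n = (\<Sum>k\<in>{1..m} \<union> {m<..n}. 1 / real k)"
      unfolding harm_def using n(1) by (intro sum.cong) (auto simp: field_simps)
    also have "\<dots> = harm m + S"
      unfolding harm_def S_def K_def by (subst sum.union_disjoint) (auto simp: field_simps)
    finally show ?thesis .
  qed
  then have S: "1 \<le> S" using n(2) by simp
  define lo hi c :: "nat \<Rightarrow> real" where "lo k = 1 / 2 ^ (k+1)" and "hi k = 1 / 2 ^ k"
    and "c k = 2 ^ (k+1) / (k * S)" for k
  have K: "1 \<le> k" "hi k \<le> 1 / 2 ^ m" "1 / 2 ^ (n+1) \<le> lo k" "lo k \<le> hi k" "0 \<le> c k" if "k \<in> K" for k
    using that S unfolding K_def lo_def hi_def c_def
    by (auto simp: field_simps intro!: power_increasing)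
  have le1: "1 \<le> (\<Sum>k\<in>K. c k * (hi k - lo k))"
  proof -
    have "(\<Sum>k\<in>K. c k * (hi k - lo k)) = (\<Sum>k\<in>K. 1 / real k / S)"
      by (intro sum.cong) (use K S in \<open>auto simp: lo_def hi_def c_def field_simps\<close>)
    also have "\<dots> = 1" using S unfolding S_def sum_divide_distrib[symmetric] by simp
    finally show ?thesis by simp
  qed
  \<comment> \<open>Adjacent levels share a radius, \<open>lo k = hi (k + 1)\<close>, which the
    half-open annuli assign to one of them only.\<close>
  have dis: "disjoint_family_on (\<lambda>k. {x. lo k \<le> dist x0 x \<and> dist x0 x < hi k}) K"
  proof -
    have "hi j \<le> lo k" if "k < j" for k j
      unfolding lo_def hi_def using that by (intro divide_left_mono power_increasing) auto
    then have "\<not> (dist x0 x < hi j \<and> lo k \<le> dist x0 x)" if "k < j" for k j x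
      using that by (meson not_less order_trans)
    then show ?thesis unfolding disjoint_family_on_def by (fastforce simp: neq_iff)
  qed
  have energy: "(\<integral>\<^sup>+x\<in>D. Q x * epowr (radial_step x0 K lo hi c x) \<alpha> \<partial>\<mu>) < 1"
  proof -
    have "(\<integral>\<^sup>+x\<in>D. Q x * epowr (radial_step x0 K lo hi c x) \<alpha> \<partial>\<mu>) =
      (\<Sum>k\<in>K. ennreal (c k powr \<alpha>) * (\<integral>\<^sup>+x\<in>D \<inter> {x. lo k \<le> dist x0 x \<and> dist x0 x < hi k}. Q x \<partial>\<mu>))"
      by (rule nn_integral_radial_step[OF assms(1-3) _ _ K(5) dis]) (use assms(7) in \<open>auto simp: K_def\<close>)
    also have "\<dots> \<le> (\<Sum>k\<in>K. ennreal (1 / (2 * (k * S))))"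
    proof (rule sum_mono)
      fix k assume k: "k \<in> K"
      have "(\<integral>\<^sup>+x\<in>D \<inter> {x. lo k \<le> dist x0 x \<and> dist x0 x < hi k}. Q x \<partial>\<mu>) \<le> (\<integral>\<^sup>+ x \<in> ball x0 (hi k) \<inter> D. Q x \<partial>\<mu>)"
        by (intro nn_integral_mono mult_left_mono) (auto simp: indicator_def)
      also have "\<dots> \<le> ennreal (hi k powr \<alpha> * ln (1 / hi k) powr (\<alpha> - 1) / (2 * 2 powr \<alpha>))"
        using K(2)[OF k] m(1) by (intro \<delta>(2)) (auto simp: hi_def)
      finally have "ennreal (c k powr \<alpha>) * (\<integral>\<^sup>+x\<in>D \<inter> {x. lo k \<le> dist x0 x \<and> dist x0 x < hi k}. Q x \<partial>\<mu>)
         \<le> ennreal (c k powr \<alpha>) * ennreal (hi k powr \<alpha> * ln (1 / hi k) powr (\<alpha> - 1) / (2 * 2 powr \<alpha>))"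
        by (intro mult_left_mono) auto
      also have "\<dots> \<le> ennreal (1 / (2 * (k * S)))"
        using log_weight_bound[OF K(1)[OF k] S assms(7)]
        by (subst ennreal_mult[symmetric]) (auto simp: hi_def c_def intro!: ennreal_leI)
      finally show "ennreal (c k powr \<alpha>) * (\<integral>\<^sup>+x\<in>D \<inter> {x. lo k \<le> dist x0 x \<and> dist x0 x < hi k}. Q x \<partial>\<mu>)
         \<le> ennreal (1 / (2 * (k * S)))" .
    qed
    also have "\<dots> = ennreal (\<Sum>k\<in>K. 1 / (2 * (k * S)))"
      using S by (intro sum_ennreal) auto
    also have "(\<Sum>k\<in>K. 1 / (2 * (k * S))) = (\<Sum>k\<in>K. 1 / real k) / (2 * S)"
      unfolding sum_divide_distrib by (intro sum.cong) auto
    also have "\<dots> = 1 / 2" using S unfolding S_def[symmetric] by simp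
    also have "ennreal (1 / 2) < 1" by (subst ennreal_1[symmetric], rule ennreal_lessI) auto
    finally show ?thesis .
  qed
  \<comment> \<open>The witness is \<open>lo n\<close>, the inner radius of the innermost annulus:
    paths that come closer to \<open>x0\<close> and also reach \<open>R\<close> cross every
    level.\<close>
  show ?thesis
  proof (rule that[of "1 / 2 ^ (n+1)"])
    fix \<Gamma> :: "(real \<Rightarrow> 'a) set"
    assume \<Gamma>: "\<And>\<gamma>. \<gamma> \<in> \<Gamma> \<Longrightarrow> path \<gamma> \<and> (\<exists>x\<in>path_image \<gamma>. dist x0 x < 1 / 2 ^ (n+1)) \<and> (\<exists>y\<in>path_image \<gamma>. R \<le> dist x0 y)"
    have "radial_step x0 K lo hi c \<in> admissible \<Gamma>"
    proof (rule radial_step_admissible[OF _ le1 K(4,5)])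
      show "finite K" by (simp add: K_def)
      fix \<gamma> assume \<gamma>: "\<gamma> \<in> \<Gamma>"
      show "path \<gamma>" using \<Gamma>[OF \<gamma>] by simp
      show "\<exists>x\<in>path_image \<gamma>. \<forall>k\<in>K. dist x0 x \<le> lo k"
        using \<Gamma>[OF \<gamma>] K(3) by (meson less_imp_le order_trans)
      show "\<exists>y\<in>path_image \<gamma>. \<forall>k\<in>K. hi k \<le> dist x0 y"
        using \<Gamma>[OF \<gamma>] K(2) m(2) by (meson less_imp_le order_trans)
    qed
    then show "\<exists>\<rho>\<in>admissible \<Gamma>. (\<integral>\<^sup>+x\<in>D. Q x * epowr (\<rho> x) \<alpha> \<partial>\<mu>) < 1" using energy by blast
  qed simp
qed


subsection \<open>Hausdorff dimension of connected sets\<close>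

text \<open>The map \<open>dist p\<close> is 1-Lipschitz and sends a connected set onto a set
  containing \<open>{0..dist p q}\<close>. Any cover therefore has diameters adding up to at least
  \<open>dist p q\<close>, and an exponent below 1 does not decrease diameters that are at most 1.
  This supplies \<open>1 \<le> \<alpha>\<close>.\<close>

lemma hausdorff_dim_connected_ge_1:
  assumes "connected D" "p \<in> D" "q \<in> D" "p \<noteq> q"
  shows "1 \<le> hausdorff_dim D"
  unfolding hausdorff_dim_def
proof (rule INF_greatest)
  fix s assume "s \<in> {s. 0 \<le> s \<and> hausdorff_measure s D = 0}"
  then have s: "0 \<le> s" "hausdorff_measure s D = 0" by auto
  show "1 \<le> ereal s"
  proof (rule ccontr)
    assume "\<not> 1 \<le> ereal s"
    then have s1: "s < 1" by auto
    have "ennreal (dist p q) \<le> hausdorff_premeasure 1 s D"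
      unfolding hausdorff_premeasure_def
    proof (rule INF_greatest)
      fix C :: "nat \<Rightarrow> 'a set"
      assume "C \<in> {C. D \<subseteq> (\<Union>i. C i) \<and> (\<forall>i. bounded (C i) \<and> diameter (C i) \<le> 1)}"
      then have C: "D \<subseteq> (\<Union>i. C i)" "\<And>i. bounded (C i)" "\<And>i. diameter (C i) \<le> 1" by auto
      \<comment> \<open>The image of \<open>C i\<close> under \<open>dist p\<close> need not be
        measurable; it is enclosed in an interval of length \<open>diameter (C i)\<close>.\<close>
      define a where "a i = Inf (dist p ` C i)" for i
      define I where "I i = (if C i = {} then {} else {a i..a i + diameter (C i)})" for i
      have I: "dist p x \<in> I i" if x: "x \<in> C i" for x i
      proof -
        have "dist p x - diameter (C i) \<le> a i" unfolding a_def
        proof (rule cInf_greatest)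
          fix z assume "z \<in> dist p ` C i"
          then obtain y where y: "y \<in> C i" "z = dist p y" by auto
          show "dist p x - diameter (C i) \<le> z"
            using diameter_bounded_bound[OF C(2) y(1) x] y(2) dist_triangle[of p x y] by simp
        qed (use x in auto)
        moreover have "a i \<le> dist p x" unfolding a_def
          by (rule cInf_lower) (use x in \<open>auto intro!: bdd_belowI2[of _ 0]\<close>)
        ultimately show ?thesis using x by (auto simp: I_def)
      qed
      have "{0..dist p q} \<subseteq> dist p ` D"
      proof -
        have "connected (dist p ` D)"
          by (rule connected_continuous_image[OF _ assms(1)]) (intro continuous_intros)
        moreover have "0 \<in> dist p ` D" by (rule image_eqI[OF _ assms(2)]) simp
        moreover have "dist p q \<in> dist p ` D" using assms(3) by (rule imageI)
        ultimately show ?thesis by (rule connected_contains_Icc)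
      qed
      also have "\<dots> \<subseteq> (\<Union>i. I i)"
      proof
        fix z assume "z \<in> dist p ` D"
        then obtain x where x: "x \<in> D" "z = dist p x" by auto
        then obtain i where "x \<in> C i" using C(1) by auto
        then show "z \<in> (\<Union>i. I i)" using I x(2) by blast
      qed
      finally have sub: "{0..dist p q} \<subseteq> (\<Union>i. I i)" .
      have Ib: "I i \<in> sets lborel" for i unfolding I_def by simp
      have "ennreal (dist p q) = emeasure lborel {0..dist p q}" by simp
      also have "\<dots> \<le> emeasure lborel (\<Union>i. I i)"
        using sub by (rule emeasure_mono) (intro sets.countable_UN Ib image_subsetI)
      also have "\<dots> \<le> (\<Sum>i. emeasure lborel (I i))"
        by (rule emeasure_subadditive_countably) (intro Ib image_subsetI)
      also have "\<dots> \<le> (\<Sum>i. if C i = {} then 0 else epowr (ennreal (diameter (C i))) s)"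
      proof (rule suminf_le)
        fix i
        have d: "0 \<le> diameter (C i)" using C(2) by (rule diameter_ge_0)
        have "diameter (C i) powr 1 \<le> diameter (C i) powr s"
          using s1 d C(3)[of i] by (intro powr_mono') auto
        then have "ennreal (diameter (C i)) \<le> epowr (ennreal (diameter (C i))) s"
          using d C(3)[of i] by (auto simp: epowr_def intro: ennreal_leI)
        then show "emeasure lborel (I i) \<le> (if C i = {} then 0 else epowr (ennreal (diameter (C i))) s)"
          using d by (auto simp: I_def)
      qed auto
      finally show "ennreal (dist p q) \<le> (\<Sum>i. if C i = {} then 0 else epowr (ennreal (diameter (C i))) s)" .
    qed
    also have "\<dots> \<le> hausdorff_measure s D"
      unfolding hausdorff_measure_def by (rule SUP_upper) simp
    finally show False using s(2) assms(4) by simp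
  qed
qed

text \<open>A cover by copies of one singleton has diameter 0 throughout. This lets a dimension
  above 1 exclude an empty or one-point image domain.\<close>

lemma hausdorff_dim_subsingleton_le_1:
  assumes "D \<subseteq> {p}"
  shows "hausdorff_dim D \<le> 1"
proof -
  have "hausdorff_premeasure \<delta> 1 D \<le> 0" if "0 < \<delta>" for \<delta>
    unfolding hausdorff_premeasure_def
    by (rule INF_lower2[of "\<lambda>_. {p}"]) (use assms that in \<open>auto simp: epowr_def\<close>)
  then have "hausdorff_measure 1 D \<le> 0"
    unfolding hausdorff_measure_def by (intro SUP_least) auto
  then show ?thesis
    unfolding hausdorff_dim_def by (intro INF_lower2[of 1]) (auto simp: one_ereal_def)
qed

subsection \<open>Local connectedness at weakly flat boundary points\<close>

text \<open>Stop the path at the first time it is outside \<open>U\<close>: earlier points lie in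
  \<open>U\<close>, so the stopping point lies in the closure but not in \<open>U\<close>, hence on
  the frontier.\<close>

lemma initial_subcontinuum:
  fixes g :: "real \<Rightarrow> 'a::metric_space"
  assumes "path g" "open U" "pathstart g \<in> U" "pathfinish g \<notin> U"
  obtains E where "compact E" "path_connected E" "pathstart g \<in> E" "E \<subseteq> path_image g"
    "E \<subseteq> closure U" "E \<inter> frontier U \<noteq> {}"
proof -
  have g: "continuous_on {0..1} g" using assms(1) by (simp add: path_def)
  define T where "T = {0..1} \<inter> g -` (- U)"
  have T: "closed T" unfolding T_def
    using assms(2) by (intro continuous_closed_preimage g) auto
  have "1 \<in> T" using assms(4) by (simp add: T_def pathfinish_def)
  define t where "t = Inf T"
  have bdd: "bdd_below T" unfolding T_def by (auto intro: bdd_belowI[of _ 0])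
  have "t \<in> T" unfolding t_def
    using \<open>1 \<in> T\<close> by (intro closed_contains_Inf T bdd) auto
  then have t: "t \<in> {0..1}" "g t \<notin> U" by (auto simp: T_def)
  have "t \<noteq> 0" using t(2) assms(3) by (auto simp: pathstart_def)
  then have "0 < t" using t(1) by auto
  have "s \<notin> T" if "s < t" for s using that cInf_lower[OF _ bdd, of s] unfolding t_def by auto
  then have U: "g s \<in> U" if "s \<in> {0..<t}" for s using that t(1) by (auto simp: T_def)
  have gt: "continuous_on {0..t} g" using g t(1) by (auto intro: continuous_on_subset)
  have cl: "g ` {0..t} \<subseteq> closure U"
  proof -
    have "g ` {0..<t} \<subseteq> closure U" using U closure_subset[of U] by blast
    then have "g ` closure {0..<t} \<subseteq> closure U"
      using gt \<open>0 < t\<close> by (intro image_closure_subset) auto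
    then show ?thesis using \<open>0 < t\<close> by simp
  qed
  show ?thesis
  proof (rule that[of "g ` {0..t}"])
    show "compact (g ` {0..t})" by (rule compact_continuous_image[OF gt]) simp
    show "path_connected (g ` {0..t})"
      by (rule path_connected_continuous_image[OF gt]) (simp add: convex_imp_path_connected)
    show "pathstart g \<in> g ` {0..t}" using t(1) by (auto simp: pathstart_def)
    show "g ` {0..t} \<subseteq> path_image g" using t(1) by (auto simp: path_image_def)
    show "g ` {0..t} \<inter> frontier U \<noteq> {}"
    proof -
      have "g t \<in> g ` {0..t}" using t(1) by auto
      then show ?thesis using cl t(2) assms(2) by (auto simp: frontier_def interior_open)
    qed
  qed (rule cl)
qed

lemma frontier_notin_open: "open S \<Longrightarrow> x \<in> frontier S \<Longrightarrow> x \<notin> S"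
  by (simp add: frontier_def interior_open)

text \<open>A connected set that meets \<open>V\<close> and leaves \<open>U\<close> also leaves the
  smaller \<open>V\<close>, hence crosses both frontiers. This trades the frontier conditions for
  ones that are easier to verify.\<close>

lemma weakly_flat_atE:
  assumes "weakly_flat_at \<mu> D \<alpha> x0" "0 < P" "open U" "x0 \<in> U"
  obtains V where "open V" "x0 \<in> V" "V \<subseteq> U"
    "\<forall>E F. compact E \<longrightarrow> connected E \<longrightarrow> E \<subseteq> D \<longrightarrow> E \<inter> V \<noteq> {} \<longrightarrow> E - U \<noteq> {} \<longrightarrow>
      compact F \<longrightarrow> connected F \<longrightarrow> F \<subseteq> D \<longrightarrow> F \<inter> V \<noteq> {} \<longrightarrow> F - U \<noteq> {} \<longrightarrow>
       ennreal P \<le> modulus \<mu> D \<alpha> (joining_paths E F D)"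
proof -
  obtain V where V: "open V" "x0 \<in> V" "V \<subseteq> U"
    "\<forall>E F. compact E \<and> connected E \<and> E \<subseteq> D \<and> compact F \<and> connected F \<and> F \<subseteq> D \<and>
       E \<inter> frontier U \<noteq> {} \<and> E \<inter> frontier V \<noteq> {} \<and> F \<inter> frontier U \<noteq> {} \<and> F \<inter> frontier V \<noteq> {} \<longrightarrow>
       ennreal P \<le> modulus \<mu> D \<alpha> (joining_paths E F D)"
  proof -
    note wf = assms(1)[unfolded weakly_flat_at_def, THEN spec[of _ P], THEN spec[of _ U]]
    have "0 < P \<and> open U \<and> x0 \<in> U" using assms(2-4) by simp
    from mp[OF wf this] show thesis by (elim exE conjE) (rule that)
  qed
  have meets: "E \<inter> frontier U \<noteq> {} \<and> E \<inter> frontier V \<noteq> {}"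
    if "connected E" "E \<inter> V \<noteq> {}" "E - U \<noteq> {}" for E
    using that V(3) by (intro conjI connected_Int_frontier) auto
  show ?thesis
    by (rule that[OF V(1-3)], intro allI impI, rule V(4)[rule_format]) (simp add: meets)
qed

text \<open>Two points near \<open>x0\<close> lie on continua inside \<open>cball x0 (r/2)\<close>
  that leave \<open>U\<close>. If each path joining these continua left \<open>ball x0 r\<close>, it
  would cross the annulus between \<open>r/2\<close> and \<open>r\<close>, and the modulus would be
  at most \<open>(2/r) powr \<alpha>\<close> times the measure of the ball, against weak
  flatness.\<close>

lemma weakly_flat_imp_locally_path_connected:
  fixes \<mu> :: "'a::metric_space measure"
  assumes \<mu>: "locally_finite_borel \<mu>" and D: "domain D" and x0: "x0 \<in> frontier D"
    and wf: "weakly_flat_at \<mu> D \<alpha> x0" and \<alpha>: "0 < \<alpha>" and R: "0 < R"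
  obtains V where "open V" "x0 \<in> V"
    "\<And>x y. x \<in> D \<inter> V \<Longrightarrow> y \<in> D \<inter> V \<Longrightarrow> path_component (D \<inter> ball x0 R) x y"
proof -
  have oD: "open D" and pD: "path_connected D" using D by (auto simp: domain_def)
  have x0D: "x0 \<notin> D" using frontier_notin_open[OF oD x0] .
  obtain p where p: "p \<in> D" using x0 by (cases "D = {}") auto
  have \<mu>s: "sets \<mu> = sets borel" using \<mu> by (simp add: locally_finite_borel_def)
  obtain r1 where r1: "0 < r1" "emeasure \<mu> (ball x0 r1) < \<infinity>"
    using \<mu> by (auto simp: locally_finite_borel_def)
  \<comment> \<open>The three bounds keep the ball inside \<open>ball x0 R\<close>, give it finite
    measure, and leave the base point \<open>p\<close> outside \<open>U\<close>.\<close>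
  define r where "r = min R (min r1 (dist x0 p))"
  have r: "0 < r" "r \<le> R" "r \<le> r1" "r \<le> dist x0 p"
    using R r1(1) p x0D unfolding r_def by auto
  have ball: "emeasure \<mu> (ball x0 r) < \<infinity>"
    using emeasure_mono[of "ball x0 r" "ball x0 r1" \<mu>] r(3) r1(2) \<mu>s by (auto simp: subset_ball)
  then have fin: "ennreal ((2/r) powr \<alpha>) * emeasure \<mu> (ball x0 r) < \<infinity>"
    by (simp add: ennreal_mult_less_top)
  \<comment> \<open>\<open>P\<close> exceeds the energy bound of the density on the annulus; adding
    1 makes this strict and \<open>P\<close> positive.\<close>
  define P where "P = enn2real (ennreal ((2/r) powr \<alpha>) * emeasure \<mu> (ball x0 r)) + 1"
  have P: "0 < P" "ennreal ((2/r) powr \<alpha>) * emeasure \<mu> (ball x0 r) < ennreal P"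
    using fin unfolding P_def by (auto simp: add_nonneg_pos enn2real_less_iff[symmetric] simp del: enn2real_less_iff)
  define U where "U = ball x0 (r/2)"
  have U: "open U" "x0 \<in> U" "p \<notin> U" "closure U \<subseteq> cball x0 (r/2)"
    using r closure_minimal[OF ball_subset_cball closed_cball, of x0 "r/2"] by (auto simp: U_def)
  obtain V where V: "open V" "x0 \<in> V" "V \<subseteq> U"
    "\<forall>E F. compact E \<longrightarrow> connected E \<longrightarrow> E \<subseteq> D \<longrightarrow> E \<inter> V \<noteq> {} \<longrightarrow> E - U \<noteq> {} \<longrightarrow>
      compact F \<longrightarrow> connected F \<longrightarrow> F \<subseteq> D \<longrightarrow> F \<inter> V \<noteq> {} \<longrightarrow> F - U \<noteq> {} \<longrightarrow>
       ennreal P \<le> modulus \<mu> D \<alpha> (joining_paths E F D)"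
    using weakly_flat_atE[OF wf P(1) U(1,2)] .
  have cont: "\<exists>E. compact E \<and> path_connected E \<and> E \<subseteq> D \<and> x \<in> E \<and> E \<subseteq> cball x0 (r/2) \<and> E - U \<noteq> {}"
    if x: "x \<in> D \<inter> V" for x
  proof -
    obtain g where g: "path g" "path_image g \<subseteq> D" "pathstart g = x" "pathfinish g = p"
      using pD x p unfolding path_connected_def by blast
    obtain E where E: "compact E" "path_connected E" "pathstart g \<in> E" "E \<subseteq> path_image g"
      "E \<subseteq> closure U" "E \<inter> frontier U \<noteq> {}"
      using initial_subcontinuum[OF g(1) U(1)] x V(3) U(3) g(3,4) by blast
    then show ?thesis using g U(4) frontier_notin_open[OF U(1)] by (intro exI[of _ E]) blast
  qed
  show ?thesis
  proof (rule that[OF V(1,2)])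
    fix x y assume x: "x \<in> D \<inter> V" and y: "y \<in> D \<inter> V"
    obtain E where E: "compact E" "path_connected E" "E \<subseteq> D" "x \<in> E" "E \<subseteq> cball x0 (r/2)"
        "E - U \<noteq> {}" using cont[OF x] by auto
    obtain F where F: "compact F" "path_connected F" "F \<subseteq> D" "y \<in> F" "F \<subseteq> cball x0 (r/2)"
        "F - U \<noteq> {}" using cont[OF y] by auto
    have "\<exists>\<gamma>\<in>joining_paths E F D. path_image \<gamma> \<subseteq> ball x0 r"
    proof (rule ccontr)
      assume "\<not> ?thesis"
      then have out: "\<exists>z\<in>path_image \<gamma>. r \<le> dist x0 z" if "\<gamma> \<in> joining_paths E F D" for \<gamma>
        using that by (auto simp: subset_iff not_less)
      define \<rho> where "\<rho> = radial_step x0 {()} (\<lambda>_. r/2) (\<lambda>_. r) (\<lambda>_. 2/r)"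
      have "\<rho> \<in> admissible (joining_paths E F D)"
        unfolding \<rho>_def
      proof (rule radial_step_admissible)
        fix \<gamma> assume \<gamma>: "\<gamma> \<in> joining_paths E F D"
        then show "path \<gamma>" by (auto simp: joining_paths_def paths_in_def)
        have "pathstart \<gamma> \<in> path_image \<gamma>" "dist x0 (pathstart \<gamma>) \<le> r/2"
          using \<gamma> E(5) by (auto simp: joining_paths_def)
        then show "\<exists>x\<in>path_image \<gamma>. \<forall>k\<in>{()}. dist x0 x \<le> r/2" by blast
        show "\<exists>y\<in>path_image \<gamma>. \<forall>k\<in>{()}. r \<le> dist x0 y" using out[OF \<gamma>] by simp
      qed (use r in \<open>auto simp: field_simps\<close>)
      then have "modulus \<mu> D \<alpha> (joining_paths E F D) \<le> (\<integral>\<^sup>+x\<in>D. epowr (\<rho> x) \<alpha> \<partial>\<mu>)"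
        unfolding modulus_def by (rule INF_lower)
      also have "\<dots> = (\<integral>\<^sup>+x\<in>D. 1 * epowr (\<rho> x) \<alpha> \<partial>\<mu>)" by simp
      also have "\<dots> = ennreal ((2/r) powr \<alpha>) * (\<integral>\<^sup>+x\<in>D \<inter> {x. r/2 \<le> dist x0 x \<and> dist x0 x < r}. 1 \<partial>\<mu>)"
        unfolding \<rho>_def using r(1)
        by (intro nn_integral_annulus \<mu>s oD \<alpha>) (auto simp: measurable_on_domain_def)
      also have "\<dots> \<le> ennreal ((2/r) powr \<alpha>) * (\<integral>\<^sup>+x. indicator (ball x0 r) x \<partial>\<mu>)"
        by (intro mult_left_mono nn_integral_mono) (auto simp: indicator_def)
      also have "\<dots> = ennreal ((2/r) powr \<alpha>) * emeasure \<mu> (ball x0 r)"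
        using \<mu>s by simp
      also have "\<dots> < ennreal P" by (rule P(2))
      also have "\<dots> \<le> modulus \<mu> D \<alpha> (joining_paths E F D)"
        using E F x y by (intro V(4)[rule_format] path_connected_imp_connected) auto
      finally show False by simp
    qed
    then obtain \<gamma> where \<gamma>: "\<gamma> \<in> joining_paths E F D" "path_image \<gamma> \<subseteq> ball x0 r" by auto
    \<comment> \<open>Join \<open>x\<close> to \<open>y\<close> by moving within \<open>E\<close>,
      along \<open>\<gamma>\<close>, and within \<open>F\<close>; all three pieces stay in the
      ball.\<close>
    have sub: "E \<subseteq> D \<inter> ball x0 R" "F \<subseteq> D \<inter> ball x0 R" using E(3,5) F(3,5) r by (force simp: subset_iff)+
    have "path_component (D \<inter> ball x0 R) x (pathstart \<gamma>)"
      using E(2,4) \<gamma>(1) by (intro path_component_of_subset[OF sub(1)])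
        (auto simp: path_connected_component joining_paths_def)
    moreover have "path_component (D \<inter> ball x0 R) (pathstart \<gamma>) (pathfinish \<gamma>)"
      unfolding path_component_def
      using \<gamma> subset_ball[OF r(2)] by (intro exI[of _ \<gamma>]) (auto simp: joining_paths_def paths_in_def)
    moreover have "path_component (D \<inter> ball x0 R) (pathfinish \<gamma>) y"
      using F(2,4) \<gamma>(1) by (intro path_component_of_subset[OF sub(2)])
        (auto simp: path_connected_component joining_paths_def)
    ultimately show "path_component (D \<inter> ball x0 R) x y" by (meson path_component_trans)
  qed
qed

subsection \<open>Boundary extension\<close>

text \<open>Up to values outside the unit interval, each path joining the image sets in
  \<open>D'\<close> is \<open>f\<close> composed with a path joining \<open>E\<close> and
  \<open>F\<close> in \<open>D\<close>, obtained through \<open>g\<close>. So a function admissible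
  for the image family is admissible for all these joining paths, and the defining modulus
  inequality applies.\<close>

lemma Q_homeomorphism_modulus_le:
  assumes Q: "Q_homeomorphism \<mu> D \<alpha> \<mu>' D' \<alpha>' Q f" and fg: "homeomorphism D D' f g"
    and sub: "E \<subseteq> D" "F \<subseteq> D" and \<rho>: "\<rho> \<in> admissible (joining_paths E F D)"
  shows "modulus \<mu>' D' \<alpha>' (joining_paths (f ` E) (f ` F) D') \<le> (\<integral>\<^sup>+ x \<in> D. Q x * epowr (\<rho> x) \<alpha> \<partial>\<mu>)"
proof -
  let ?\<Gamma> = "joining_paths E F D"
  have "admissible ((\<lambda>\<gamma>. f \<circ> \<gamma>) ` ?\<Gamma>) \<subseteq> admissible (joining_paths (f ` E) (f ` F) D')"
  proof
    fix \<sigma> assume \<sigma>: "\<sigma> \<in> admissible ((\<lambda>\<gamma>. f \<circ> \<gamma>) ` ?\<Gamma>)"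
    have "1 \<le> line_integral \<gamma> \<sigma>" if "\<gamma> \<in> joining_paths (f ` E) (f ` F) D'" for \<gamma>
    proof -
      have \<gamma>: "path \<gamma>" "path_image \<gamma> \<subseteq> D'" "\<gamma> 0 \<in> f ` E" "\<gamma> 1 \<in> f ` F"
        using that by (auto simp: joining_paths_def paths_in_def pathstart_def pathfinish_def)
      have D': "\<gamma> t \<in> D'" if "t \<in> {0..1}" for t using \<gamma>(2) that by (auto simp: path_image_def)
      have "path (g \<circ> \<gamma>)"
        using fg \<gamma>(1,2) by (intro path_continuous_image) (auto simp: homeomorphism_def intro: continuous_on_subset)
      moreover have "path_image (g \<circ> \<gamma>) \<subseteq> D"
        using fg \<gamma>(2) by (auto simp: homeomorphism_def path_image_compose)
      moreover have "g (\<gamma> 0) \<in> E" "g (\<gamma> 1) \<in> F"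
        using \<gamma>(3,4) sub homeomorphism_apply1[OF fg] by (auto simp: subset_iff)
      ultimately have "g \<circ> \<gamma> \<in> ?\<Gamma>"
        by (simp add: joining_paths_def paths_in_def pathstart_def pathfinish_def)
      then have "1 \<le> line_integral (f \<circ> (g \<circ> \<gamma>)) \<sigma>" using \<sigma> by (auto simp: admissible_def)
      also have "\<dots> = line_integral \<gamma> \<sigma>"
        by (rule line_integral_cong) (simp add: homeomorphism_apply2[OF fg D'])
      finally show ?thesis .
    qed
    then show "\<sigma> \<in> admissible (joining_paths (f ` E) (f ` F) D')" using \<sigma> by (auto simp: admissible_def)
  qed
  then have "modulus \<mu>' D' \<alpha>' (joining_paths (f ` E) (f ` F) D') \<le> modulus \<mu>' D' \<alpha>' ((\<lambda>\<gamma>. f \<circ> \<gamma>) ` ?\<Gamma>)"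
    unfolding modulus_def by (rule INF_superset_mono) simp
  also have "\<dots> \<le> (\<integral>\<^sup>+ x \<in> D. Q x * epowr (\<rho> x) \<alpha> \<partial>\<mu>)"
    using Q \<rho> unfolding Q_homeomorphism_def by (auto simp: joining_paths_def)
  finally show ?thesis .
qed

text \<open>If the limit lay in \<open>D'\<close>, continuity of \<open>g\<close> would carry the
  sequence back to a point of \<open>D\<close>, while it tends to \<open>x0\<close>. Together with
  membership in the closure this places boundary limits on \<open>frontier D'\<close>.\<close>

lemma image_limit_notin:
  fixes f :: "'a::metric_space \<Rightarrow> 'b::metric_space"
  assumes fg: "homeomorphism D D' f g" and x0: "x0 \<notin> D"
    and X: "\<And>k::nat. X k \<in> D" "X \<longlonglongrightarrow> x0" and y: "(\<lambda>k. f (X k)) \<longlonglongrightarrow> y"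
  shows "y \<notin> D'"
proof
  assume "y \<in> D'"
  have "continuous_on D' g" using fg by (simp add: homeomorphism_def)
  then have "(\<lambda>k. g (f (X k))) \<longlonglongrightarrow> g y"
    using y by (rule continuous_on_tendsto_compose)
       (use \<open>y \<in> D'\<close> X(1) homeomorphism_image1[OF fg] in auto)
  then have "X \<longlonglongrightarrow> g y" using homeomorphism_apply1[OF fg X(1)] by simp
  then have "x0 = g y" using LIMSEQ_unique[OF X(2)] by simp
  then show False using x0 \<open>y \<in> D'\<close> fg by (auto simp: homeomorphism_def)
qed

lemma compact_connected_path_image:
  assumes "path_component S x y"
  obtains E where "compact E" "connected E" "E \<subseteq> S" "x \<in> E" "y \<in> E"
proof -
  obtain c where c: "path c" "path_image c \<subseteq> S" "pathstart c = x" "pathfinish c = y"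
    using assms unfolding path_component_def by auto
  show ?thesis
    by (rule that[of "path_image c"])
       (use c in \<open>auto simp: compact_path_image connected_path_image\<close>)
qed

text \<open>Compactness gives a subsequential limit \<open>y\<close>. If \<open>f\<close> did not
  tend to \<open>y\<close>, continua \<open>C\<close> arbitrarily near \<open>x0\<close> would have
  images running from near \<open>y\<close> out of \<open>ball y e\<close>, as does one fixed
  continuum. Weak flatness at \<open>y\<close> makes the modulus at least 1, and the logarithmic
  density makes it smaller.\<close>

lemma Q_homeomorphism_boundary_limit:
  fixes \<mu> :: "'a::metric_space measure" and \<mu>' :: "'b::metric_space measure"
  assumes \<mu>: "locally_finite_borel \<mu>" and D: "domain D" and D': "domain D'"
    and \<alpha>: "1 \<le> \<alpha>" and wf: "weakly_flat_at \<mu> D \<alpha> x0" and wf': "weakly_flat_boundary \<mu>' D' \<alpha>'"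
    and cD': "compact (closure D')" and x0: "x0 \<in> frontier D"
    and Q: "measurable_on_domain \<mu> D Q" and reg: "upper_regular_at \<mu> l x0"
    and lim: "Limsup (at_right 0)
             (\<lambda>\<epsilon>::real. 1 / emeasure \<mu> (ball x0 \<epsilon> \<inter> D) * (\<integral>\<^sup>+ x \<in> ball x0 \<epsilon> \<inter> D. Q x \<partial>\<mu>)) < \<infinity>"
    and l: "l \<in> o[at_right 0](\<lambda>\<epsilon>. \<epsilon> powr \<alpha> * ln (1 / \<epsilon>) powr (\<alpha> - 1))"
    and f: "Q_homeomorphism \<mu> D \<alpha> \<mu>' D' \<alpha>' Q f" and fg: "homeomorphism D D' f g"
  obtains y where "y \<in> frontier D'" "(f \<longlongrightarrow> y) (at x0 within D)"
proof -
  have oD: "open D" and oD': "open D'" and pD': "path_connected D'"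
    using D D' by (auto simp: domain_def)
  have \<mu>s: "sets \<mu> = sets borel" using \<mu> by (simp add: locally_finite_borel_def)
  have x0D: "x0 \<notin> D" using frontier_notin_open[OF oD x0] .
  have fD: "f x \<in> D'" if "x \<in> D" for x using fg that by (auto simp: homeomorphism_def)
  have "x0 \<in> closure D" using x0 by (simp add: frontier_def)
  then obtain X0 where X0: "\<And>k::nat. X0 k \<in> D" "X0 \<longlonglongrightarrow> x0"
    unfolding closure_sequential by blast
  have "\<forall>k. f (X0 k) \<in> closure D'" using X0(1) fD closure_subset by blast
  then obtain y s where y: "y \<in> closure D'" "strict_mono s" "((\<lambda>k. f (X0 k)) \<circ> s) \<longlonglongrightarrow> y"
    using cD' by (metis compact_eq_seq_compact_metric seq_compactE)
  define X where "X = (\<lambda>k. X0 (s k))"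
  have X: "\<And>k. X k \<in> D" "X \<longlonglongrightarrow> x0" "(\<lambda>k. f (X k)) \<longlonglongrightarrow> y"
    using X0 y(3) LIMSEQ_subseq_LIMSEQ[OF X0(2) y(2)] by (auto simp: X_def o_def)
  have yfr: "y \<in> frontier D'"
    using image_limit_notin[OF fg x0D X] y(1) oD' by (simp add: frontier_def interior_open)
  have "(f \<longlongrightarrow> y) (at x0 within D)"
  proof (rule ccontr)
    assume "\<not> ?thesis"
    then obtain e where e: "0 < e"
      "\<And>d. 0 < d \<Longrightarrow> \<exists>z\<in>D. dist z x0 < d \<and> e \<le> dist (f z) y"
      unfolding Lim_within by (meson not_less)
    have "weakly_flat_at \<mu>' D' \<alpha>' y" using wf' yfr by (auto simp: weakly_flat_boundary_def)
    then obtain V where V: "open V" "y \<in> V" "V \<subseteq> ball y e"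
      "\<forall>E F. compact E \<longrightarrow> connected E \<longrightarrow> E \<subseteq> D' \<longrightarrow> E \<inter> V \<noteq> {} \<longrightarrow> E - ball y e \<noteq> {} \<longrightarrow>
        compact F \<longrightarrow> connected F \<longrightarrow> F \<subseteq> D' \<longrightarrow> F \<inter> V \<noteq> {} \<longrightarrow> F - ball y e \<noteq> {} \<longrightarrow>
         ennreal 1 \<le> modulus \<mu>' D' \<alpha>' (joining_paths E F D')"
      by (rule weakly_flat_atE[of _ _ _ _ 1 "ball y e"]) (use e(1) in auto)
    have evV: "\<forall>\<^sub>F k in sequentially. f (X k) \<in> V"
      using X(3) V(1,2) by (rule topological_tendstoD)
    then obtain k0 where k0: "f (X k0) \<in> V"
      by (auto dest: eventually_happens)
    obtain z0 where z0: "z0 \<in> D" "e \<le> dist (f z0) y" using e(2)[of 1] by auto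
    have "path_component D' (f (X k0)) (f z0)"
      using pD' fD X(1) z0(1) by (simp add: path_connected_component)
    then obtain E' where E': "compact E'" "connected E'" "E' \<subseteq> D'" "f (X k0) \<in> E'" "f z0 \<in> E'"
      by (rule compact_connected_path_image)
    define E where "E = g ` E'"
    have E: "compact E" "E \<subseteq> D" "f ` E = E'"
    proof -
      show "compact E" unfolding E_def
        using fg E'(1,3) by (auto intro!: compact_continuous_image simp: homeomorphism_def intro: continuous_on_subset)
      show "E \<subseteq> D" unfolding E_def using fg E'(3) by (auto simp: homeomorphism_def)
      show "f ` E = E'" unfolding E_def image_image
        using homeomorphism_apply2[OF fg] E'(3) by (force simp: subset_iff)
    qed
    \<comment> \<open>\<open>E\<close> is fixed before any radius: compactness keeps it outside
      \<open>ball x0 R\<close>, and only then are the inner radius \<open>r\<close> and the small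
      continuum \<open>C\<close> chosen in terms of \<open>R\<close>.\<close>
    have "open (- E)" "x0 \<in> - E" using E(1,2) x0D by (auto simp: compact_imp_closed)
    then obtain R where R: "0 < R" "ball x0 R \<subseteq> - E" by (meson open_contains_ball)
    obtain r where r: "0 < r"
      "\<And>\<Gamma>. (\<And>\<gamma>. \<gamma> \<in> \<Gamma> \<Longrightarrow> path \<gamma> \<and> (\<exists>x\<in>path_image \<gamma>. dist x0 x < r) \<and> (\<exists>y\<in>path_image \<gamma>. R \<le> dist x0 y)) \<Longrightarrow>
       \<exists>\<rho>\<in>admissible \<Gamma>. (\<integral>\<^sup>+x\<in>D. Q x * epowr (\<rho> x) \<alpha> \<partial>\<mu>) < 1"
      using small_energy_log_density[OF \<mu>s oD Q reg lim l \<alpha> R(1)] by blast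
    obtain W where W: "open W" "x0 \<in> W"
      "\<And>x y. x \<in> D \<inter> W \<Longrightarrow> y \<in> D \<inter> W \<Longrightarrow> path_component (D \<inter> ball x0 r) x y"
      by (rule weakly_flat_imp_locally_path_connected[OF \<mu> D x0 wf _ r(1)]) (use \<alpha> in auto)
    have "\<forall>\<^sub>F k in sequentially. f (X k) \<in> V \<and> X k \<in> W"
      using evV topological_tendstoD[OF X(2) W(1,2)] by eventually_elim auto
    then obtain k1 where k1: "f (X k1) \<in> V" "X k1 \<in> W" by (auto dest: eventually_happens)
    obtain d where "0 < d" "ball x0 d \<subseteq> W" using W(1,2) by (meson open_contains_ball)
    then obtain z1 where z1: "z1 \<in> D" "z1 \<in> W" "e \<le> dist (f z1) y"
      using e(2)[of d] by (auto simp: dist_commute subset_iff)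
    have "path_component (D \<inter> ball x0 r) (X k1) z1" using W(3) X(1) k1(2) z1(1,2) by auto
    then obtain C where C: "compact C" "connected C" "C \<subseteq> D \<inter> ball x0 r" "X k1 \<in> C" "z1 \<in> C"
      by (rule compact_connected_path_image)
    have fC: "continuous_on C f" using fg C(3) by (auto simp: homeomorphism_def intro: continuous_on_subset)
    have "\<exists>\<rho>\<in>admissible (joining_paths C E D). (\<integral>\<^sup>+x\<in>D. Q x * epowr (\<rho> x) \<alpha> \<partial>\<mu>) < 1"
    proof (rule r(2))
      fix \<gamma> assume "\<gamma> \<in> joining_paths C E D"
      then have "path \<gamma>" "pathstart \<gamma> \<in> C" "pathfinish \<gamma> \<in> E" by (auto simp: joining_paths_def paths_in_def)
      moreover from this have "dist x0 (pathstart \<gamma>) < r" "R \<le> dist x0 (pathfinish \<gamma>)"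
        using C(3) R(2) by (auto simp: subset_iff not_less[symmetric])
      ultimately show "path \<gamma> \<and> (\<exists>x\<in>path_image \<gamma>. dist x0 x < r) \<and> (\<exists>y\<in>path_image \<gamma>. R \<le> dist x0 y)"
        by (meson pathstart_in_path_image pathfinish_in_path_image)
    qed
    then obtain \<rho> where \<rho>: "\<rho> \<in> admissible (joining_paths C E D)" "(\<integral>\<^sup>+x\<in>D. Q x * epowr (\<rho> x) \<alpha> \<partial>\<mu>) < 1"
      by auto
    have "ennreal 1 \<le> modulus \<mu>' D' \<alpha>' (joining_paths (f ` C) (f ` E) D')"
    proof (rule V(4)[rule_format])
      show "compact (f ` C)" "connected (f ` C)"
        using compact_continuous_image[OF fC C(1)] connected_continuous_image[OF fC C(2)] .
      show "f ` C \<subseteq> D'" using C(3) fD by auto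
      show "f ` C \<inter> V \<noteq> {}" using C(4) k1(1) by auto
      have "f z1 \<notin> ball y e" using z1(3) by (simp add: dist_commute)
      then show "f ` C - ball y e \<noteq> {}" using C(5) by blast
      have "f z0 \<notin> ball y e" using z0(2) by (simp add: dist_commute)
      then show "f ` E - ball y e \<noteq> {}" using E(3) E'(5) by blast
    qed (use E E' k0 in auto)
    also have "\<dots> \<le> (\<integral>\<^sup>+x\<in>D. Q x * epowr (\<rho> x) \<alpha> \<partial>\<mu>)"
      by (rule Q_homeomorphism_modulus_le[OF f fg _ E(2) \<rho>(1)]) (use C(3) in auto)
    finally show False using \<rho>(2) by simp
  qed
  then show ?thesis using that yfr by blast
qed

text \<open>Were \<open>y\<close> the limit at two distinct boundary points, continua near each
  would have images running from arbitrarily small neighbourhoods of \<open>y\<close> to outside a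
  fixed one, so weak flatness would make the modulus exceed any bound. Yet their separation bounds
  it by \<open>(1/r) powr \<alpha>\<close> times the integral of \<open>Q\<close>.\<close>

lemma Q_homeomorphism_boundary_inj:
  fixes \<mu> :: "'a::metric_space measure" and \<mu>' :: "'b::metric_space measure"
  assumes \<mu>: "locally_finite_borel \<mu>" and D: "domain D" and D': "domain D'"
    and \<alpha>: "1 \<le> \<alpha>" and wf: "weakly_flat_boundary \<mu> D \<alpha>" and wf': "weakly_flat_boundary \<mu>' D' \<alpha>'"
    and x1: "x1 \<in> frontier D" and x2: "x2 \<in> frontier D" and y: "y \<in> frontier D'"
    and Q: "measurable_on_domain \<mu> D Q" and Qfin: "(\<integral>\<^sup>+ x \<in> D. Q x \<partial>\<mu>) < \<infinity>"
    and f: "Q_homeomorphism \<mu> D \<alpha> \<mu>' D' \<alpha>' Q f" and fg: "homeomorphism D D' f g"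
    and lim1: "(f \<longlongrightarrow> y) (at x1 within D)" and lim2: "(f \<longlongrightarrow> y) (at x2 within D)"
  shows "x1 = x2"
proof (rule ccontr)
  assume ne: "x1 \<noteq> x2"
  have oD: "open D" and oD': "open D'" using D D' by (auto simp: domain_def)
  have \<mu>s: "sets \<mu> = sets borel" using \<mu> by (simp add: locally_finite_borel_def)
  have yD': "y \<notin> D'" using frontier_notin_open[OF oD' y] .
  have fD: "f x \<in> D'" if "x \<in> D" for x using fg that by (auto simp: homeomorphism_def)
  \<comment> \<open>With a third of the distance, \<open>ball x2 r\<close> lies at distance at least
    \<open>2 * r\<close> from \<open>x1\<close>, leaving the annulus between \<open>r\<close> and
    \<open>2 * r\<close> for the paths to cross.\<close>
  define r where "r = dist x1 x2 / 3"
  have r: "0 < r" using ne by (simp add: r_def)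
  \<comment> \<open>\<open>t\<close> must not depend on \<open>V\<close>. All continua pass through
    one point \<open>a\<close>, whose image has positive distance \<open>t\<close> from
    \<open>y\<close>; only the other end \<open>z\<close> is chosen after \<open>V\<close>.\<close>
  have near: "\<exists>t>0. \<forall>V. open V \<and> y \<in> V \<longrightarrow> (\<exists>E. compact E \<and> connected E \<and> E \<subseteq> D \<inter> ball x r \<and>
      f ` E \<inter> V \<noteq> {} \<and> f ` E - ball y t \<noteq> {})"
    if x: "x \<in> frontier D" and limx: "(f \<longlongrightarrow> y) (at x within D)" for x
  proof -
    obtain W where W: "open W" "x \<in> W"
      "\<And>u v. u \<in> D \<inter> W \<Longrightarrow> v \<in> D \<inter> W \<Longrightarrow> path_component (D \<inter> ball x r) u v"
      by (rule weakly_flat_imp_locally_path_connected[OF \<mu> D x _ _ r, of \<alpha>])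
         (use wf x \<alpha> in \<open>auto simp: weakly_flat_boundary_def\<close>)
    have "x islimpt D"
      using x frontier_notin_open[OF oD x] by (auto simp: frontier_def closure_def)
    then have nt: "at x within D \<noteq> bot" by (simp add: trivial_limit_within)
    have ev: "\<forall>\<^sub>F z in at x within D. z \<in> D \<inter> W"
      unfolding eventually_at_topological using W(1,2) by auto
    obtain a where a: "a \<in> D \<inter> W" using eventually_happens'[OF nt ev] by auto
    define t where "t = dist y (f a)"
    have t: "0 < t" using a fD yD' unfolding t_def by auto
    show ?thesis
    proof (intro exI[of _ t] conjI t allI impI)
      fix V assume "open V \<and> y \<in> V"
      then have "\<forall>\<^sub>F z in at x within D. f z \<in> V" using topological_tendstoD[OF limx] by blast
      with ev have "\<forall>\<^sub>F z in at x within D. z \<in> D \<inter> W \<and> f z \<in> V" by eventually_elim auto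
      then obtain z where z: "z \<in> D \<inter> W" "f z \<in> V" using eventually_happens'[OF nt] by blast
      obtain E where E: "compact E" "connected E" "E \<subseteq> D \<inter> ball x r" "z \<in> E" "a \<in> E"
        using compact_connected_path_image[OF W(3)[OF z(1) a]] .
      have "f a \<notin> ball y t" by (simp add: t_def)
      then show "\<exists>E. compact E \<and> connected E \<and> E \<subseteq> D \<inter> ball x r \<and>
        f ` E \<inter> V \<noteq> {} \<and> f ` E - ball y t \<noteq> {}"
        using E z(2) by (intro exI[of _ E]) blast
    qed
  qed
  obtain t1 where t1: "0 < t1" "\<And>V. open V \<and> y \<in> V \<Longrightarrow> (\<exists>E. compact E \<and> connected E \<and>
      E \<subseteq> D \<inter> ball x1 r \<and> f ` E \<inter> V \<noteq> {} \<and> f ` E - ball y t1 \<noteq> {})" using near[OF x1 lim1] by blast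
  obtain t2 where t2: "0 < t2" "\<And>V. open V \<and> y \<in> V \<Longrightarrow> (\<exists>E. compact E \<and> connected E \<and>
      E \<subseteq> D \<inter> ball x2 r \<and> f ` E \<inter> V \<noteq> {} \<and> f ` E - ball y t2 \<noteq> {})" using near[OF x2 lim2] by blast
  \<comment> \<open>The smaller radius ensures that the images near both points leave
    \<open>U\<close>.\<close>
  define U where "U = ball y (min t1 t2)"
  have U: "open U" "y \<in> U" "U \<subseteq> ball y t1" "U \<subseteq> ball y t2" using t1(1) t2(1) by (auto simp: U_def)
  define N where "N = ennreal ((1/r) powr \<alpha>) * (\<integral>\<^sup>+ x \<in> D. Q x \<partial>\<mu>)"
  have "N < \<infinity>" using Qfin by (simp add: N_def ennreal_mult_less_top)
  \<comment> \<open>\<open>N\<close> depends neither on \<open>V\<close> nor on the continua, so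
    \<open>P\<close> can be fixed before they are chosen.\<close>
  define P where "P = enn2real N + 1"
  have P: "0 < P" "N < ennreal P"
    using \<open>N < \<infinity>\<close> unfolding P_def
    by (auto simp: add_nonneg_pos enn2real_less_iff[symmetric] simp del: enn2real_less_iff)
  have "weakly_flat_at \<mu>' D' \<alpha>' y" using wf' y by (auto simp: weakly_flat_boundary_def)
  then obtain V where V: "open V" "y \<in> V" "V \<subseteq> U"
      "\<forall>E F. compact E \<longrightarrow> connected E \<longrightarrow> E \<subseteq> D' \<longrightarrow> E \<inter> V \<noteq> {} \<longrightarrow> E - U \<noteq> {} \<longrightarrow>
        compact F \<longrightarrow> connected F \<longrightarrow> F \<subseteq> D' \<longrightarrow> F \<inter> V \<noteq> {} \<longrightarrow> F - U \<noteq> {} \<longrightarrow>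
         ennreal P \<le> modulus \<mu>' D' \<alpha>' (joining_paths E F D')"
    by (rule weakly_flat_atE[OF _ P(1) U(1,2)])
  obtain E where E: "compact E" "connected E" "E \<subseteq> D \<inter> ball x1 r" "f ` E \<inter> V \<noteq> {}" "f ` E - ball y t1 \<noteq> {}"
    using t1(2)[of V] V(1,2) by auto
  obtain F where F: "compact F" "connected F" "F \<subseteq> D \<inter> ball x2 r" "f ` F \<inter> V \<noteq> {}" "f ` F - ball y t2 \<noteq> {}"
    using t2(2)[of V] V(1,2) by auto
  define \<rho> where "\<rho> = radial_step x1 {()} (\<lambda>_. r) (\<lambda>_. 2 * r) (\<lambda>_. 1/r)"
  have \<rho>: "\<rho> \<in> admissible (joining_paths E F D)"
    unfolding \<rho>_def
  proof (rule radial_step_admissible)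
    fix \<gamma> assume \<gamma>: "\<gamma> \<in> joining_paths E F D"
    then show "path \<gamma>" by (auto simp: joining_paths_def paths_in_def)
    have "pathstart \<gamma> \<in> path_image \<gamma>" "dist x1 (pathstart \<gamma>) \<le> r"
      using \<gamma> E(3) by (auto simp: joining_paths_def)
    then show "\<exists>x\<in>path_image \<gamma>. \<forall>k\<in>{()}. dist x1 x \<le> r" by blast
    have "dist x2 (pathfinish \<gamma>) < r" using \<gamma> F(3) by (auto simp: joining_paths_def)
    then have "2 * r \<le> dist x1 (pathfinish \<gamma>)"
      using dist_triangle[of x1 x2 "pathfinish \<gamma>"] unfolding r_def by (simp add: dist_commute)
    then show "\<exists>y\<in>path_image \<gamma>. \<forall>k\<in>{()}. 2 * r \<le> dist x1 y" using pathfinish_in_path_image by blast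
  qed (use r in auto)
  have fcont: "continuous_on E f" "continuous_on F f"
    using fg E(3) F(3) by (auto simp: homeomorphism_def intro: continuous_on_subset)
  have "ennreal P \<le> modulus \<mu>' D' \<alpha>' (joining_paths (f ` E) (f ` F) D')"
  proof (rule V(4)[rule_format])
    show "compact (f ` E)" "connected (f ` E)" "compact (f ` F)" "connected (f ` F)"
      using fcont E(1,2) F(1,2) by (auto intro: compact_continuous_image connected_continuous_image)
    show "f ` E \<subseteq> D'" "f ` F \<subseteq> D'" using E(3) F(3) fD by auto
    show "f ` E - U \<noteq> {}" "f ` F - U \<noteq> {}" using E(5) F(5) U(3,4) by blast+
  qed (use E(4) F(4) in auto)
  also have "\<dots> \<le> (\<integral>\<^sup>+x\<in>D. Q x * epowr (\<rho> x) \<alpha> \<partial>\<mu>)"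
    using E(3) F(3) by (intro Q_homeomorphism_modulus_le[OF f fg _ _ \<rho>]) auto
  also have "\<dots> = ennreal ((1/r) powr \<alpha>) * (\<integral>\<^sup>+x\<in>D \<inter> {x. r \<le> dist x1 x \<and> dist x1 x < 2 * r}. Q x \<partial>\<mu>)"
    unfolding \<rho>_def using r \<alpha> by (intro nn_integral_annulus \<mu>s oD Q) auto
  also have "\<dots> \<le> N" unfolding N_def
    by (intro mult_left_mono nn_integral_mono) (auto simp: indicator_def)
  also have "\<dots> < ennreal P" by (rule P(2))
  finally show False by simp
qed

section \<open>Gluing \<open>f\<close> with its boundary limits\<close>

text \<open>Near \<open>x\<close> the values of \<open>f\<close> on \<open>D\<close> are within
  \<open>e/2\<close> of \<open>F x\<close>. The value of \<open>F\<close> at a nearby point of the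
  closure outside \<open>D\<close> is a limit of such values, hence also within
  \<open>e/2\<close>.\<close>

lemma continuous_on_closure_boundary_limits:
  fixes f :: "'a::metric_space \<Rightarrow> 'b::metric_space"
  assumes lim: "\<And>x. x \<in> closure D \<Longrightarrow> (f \<longlongrightarrow> F x) (at x within D)"
    and eq: "\<And>x. x \<in> D \<Longrightarrow> F x = f x"
  shows "continuous_on (closure D) F"
  unfolding continuous_on_iff
proof (intro ballI allI impI)
  fix x and e :: real assume x: "x \<in> closure D" and e: "0 < e"
  obtain d where d: "0 < d" "\<And>z. z \<in> D \<Longrightarrow> z \<noteq> x \<Longrightarrow> dist z x < d \<Longrightarrow> dist (f z) (F x) < e/2"
    using lim[OF x] e unfolding Lim_within by (metis half_gt_zero zero_less_dist_iff)
  \<comment> \<open>The punctured limit says nothing at \<open>z = x\<close>, where the agreement of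
    \<open>F\<close> and \<open>f\<close> fills in.\<close>
  have fz: "dist (f z) (F x) < e/2" if "z \<in> D" "dist z x < d" for z
    using d(2)[OF that(1) _ that(2)] eq[OF that(1)] e by (cases "z = x") auto
  have "dist (F w) (F x) < e" if w: "w \<in> closure D" "dist w x < d" for w
  proof (cases "w \<in> D")
    case True
    then show ?thesis using fz[OF True w(2)] eq[OF True] e by auto
  next
    case False
    then have nt: "at w within D \<noteq> bot"
      using w(1) by (auto simp: closure_def trivial_limit_within)
    have "open {z. dist z x < d}" by (intro open_Collect_less continuous_intros)
    then have "\<forall>\<^sub>F z in at w within D. dist (f z) (F x) \<le> e/2"
      unfolding eventually_at_topological using fz w(2) less_imp_le by blast
    moreover have "((\<lambda>z. dist (f z) (F x)) \<longlongrightarrow> dist (F w) (F x)) (at w within D)"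
      by (intro tendsto_intros lim w(1))
    ultimately have "dist (F w) (F x) \<le> e/2" using nt by (intro tendsto_upperbound)
    then show ?thesis using e by simp
  qed
  then show "\<exists>d>0. \<forall>w\<in>closure D. dist w x < d \<longrightarrow> dist (F w) (F x) < e" using d(1) by blast
qed

text \<open>Regularity, bounded means and the growth rate are taken at each boundary point, with a
  comparison function \<open>lam x0\<close> of its own, since the extension needs a limit everywhere
  on the frontier.\<close>

theorem theorem3p2:
  fixes \<mu> :: "'a::metric_space measure" and \<mu>' :: "'b::metric_space measure"
    and D :: "'a set" and D' :: "'b set"
    and \<alpha> \<alpha>' :: real
    and lam :: "'a \<Rightarrow> real \<Rightarrow> real"
    and Q :: "'a \<Rightarrow> ennreal"
    and f :: "'a \<Rightarrow> 'b"
  assumes "locally_finite_borel \<mu>" and "locally_finite_borel \<mu>'"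
    and "domain D" and "domain D'"
    and "hausdorff_dim D = ereal \<alpha>" and "hausdorff_dim D' = ereal \<alpha>'" and "\<alpha>' > 1"
    and "weakly_flat_boundary \<mu> D \<alpha>" and "weakly_flat_boundary \<mu>' D' \<alpha>'"
    and "compact (closure D)" and "compact (closure D')"
    and "measurable_on_domain \<mu> D Q" and "(\<integral>\<^sup>+ x \<in> D. Q x \<partial>\<mu>) < \<infinity>"
    and "\<And>x0. x0 \<in> frontier D \<Longrightarrow> upper_regular_at \<mu> (lam x0) x0"
    and "\<And>x0. x0 \<in> frontier D \<Longrightarrow>
           Limsup (at_right 0)
             (\<lambda>\<epsilon>::real. 1 / emeasure \<mu> (ball x0 \<epsilon> \<inter> D) * (\<integral>\<^sup>+ x \<in> ball x0 \<epsilon> \<inter> D. Q x \<partial>\<mu>)) < \<infinity>"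
    and "\<And>x0. x0 \<in> frontier D \<Longrightarrow>
           lam x0 \<in> o[at_right 0](\<lambda>\<epsilon>. \<epsilon> powr \<alpha> * ln (1 / \<epsilon>) powr (\<alpha> - 1))"
    and "Q_homeomorphism \<mu> D \<alpha> \<mu>' D' \<alpha>' Q f"
  shows "\<exists>F. (\<forall>x\<in>D. F x = f x) \<and> (\<exists>G. homeomorphism (closure D) (closure D') F G)"
proof -
  obtain g where fg: "homeomorphism D D' f g"
    using assms(17) by (auto simp: Q_homeomorphism_def)
  have fD: "f ` D = D'" and fcont: "continuous_on D f" using fg by (auto simp: homeomorphism_def)
  have inj: "inj_on f D" using homeomorphism_apply1[OF fg] by (metis inj_onI)
  have oD: "open D" and oD': "open D'" and "connected D"
    using assms(3,4) by (auto simp: domain_def path_connected_imp_connected)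
  \<comment> \<open>A dimension above 1 forces two points in \<open>D'\<close>, hence in
    \<open>D\<close>, and a connected set with two points has dimension at least 1. The exponent
    \<open>\<alpha> - 1\<close> of the logarithm is then nonnegative.\<close>
  have \<alpha>: "1 \<le> \<alpha>"
  proof -
    have ns: "\<not> D' \<subseteq> {p}" for p
      using hausdorff_dim_subsingleton_le_1[of D' p] assms(6,7) by auto
    obtain y where "y \<in> D'" using ns[of undefined] by auto
    then obtain z where "z \<in> D'" "z \<noteq> y" using ns[of y] by auto
    then obtain p q where "p \<in> D" "q \<in> D" "p \<noteq> q" using \<open>y \<in> D'\<close> fD by auto
    then have "1 \<le> hausdorff_dim D" using hausdorff_dim_connected_ge_1[OF \<open>connected D\<close>] by blast
    then show ?thesis using assms(5) by simp
  qed
  have "\<exists>y\<in>frontier D'. (f \<longlongrightarrow> y) (at x within D)" if x: "x \<in> frontier D" for x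
  proof -
    have "weakly_flat_at \<mu> D \<alpha> x" using assms(8) x by (auto simp: weakly_flat_boundary_def)
    then show ?thesis
      using Q_homeomorphism_boundary_limit[OF assms(1,3,4) \<alpha> _ assms(9,11) x assms(12)
          assms(14)[OF x] assms(15)[OF x] assms(16)[OF x] assms(17) fg] by blast
  qed
  then obtain h where h: "\<And>x. x \<in> frontier D \<Longrightarrow> h x \<in> frontier D'"
    "\<And>x. x \<in> frontier D \<Longrightarrow> (f \<longlongrightarrow> h x) (at x within D)" by metis
  define F where "F x = (if x \<in> D then f x else h x)" for x
  have cl: "closure D = D \<union> frontier D" "closure D' = D' \<union> frontier D'"
    using closure_Un_frontier by auto
  have FD: "F x = f x" if "x \<in> D" for x using that by (simp add: F_def)
  have Ffr: "F x = h x" if "x \<in> frontier D" for x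
    using frontier_notin_open[OF oD that] by (simp add: F_def)
  have cont: "continuous_on (closure D) F"
  proof (rule continuous_on_closure_boundary_limits[OF _ FD])
    fix x assume "x \<in> closure D"
    then show "(f \<longlongrightarrow> F x) (at x within D)"
      unfolding cl using fcont h(2) FD Ffr by (auto simp: continuous_on_def)
  qed
  have "F ` closure D = closure D'"
  proof
    show "F ` closure D \<subseteq> closure D'" unfolding cl using FD Ffr h(1) fD by auto
    \<comment> \<open>The image of the compact closure is closed and contains \<open>D'\<close>, so
      it contains the closure of \<open>D'\<close>.\<close>
    have "D' \<subseteq> F ` closure D" unfolding cl using FD fD by force
    moreover have "closed (F ` closure D)"
      by (intro compact_imp_closed compact_continuous_image cont assms(10))
    ultimately show "closure D' \<subseteq> F ` closure D" by (rule closure_minimal)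
  qed
  moreover have "inj_on F (closure D)"
  proof (rule inj_onI)
    fix x y assume xy: "x \<in> closure D" "y \<in> closure D" "F x = F y"
    \<comment> \<open>Interior and boundary values cannot coincide, since \<open>D'\<close> is open
      and misses its frontier. Injectivity thus splits into that of \<open>f\<close> and that of the
      boundary limits.\<close>
    have in': "F z \<in> D' \<longleftrightarrow> z \<in> D" if "z \<in> closure D" for z
    proof (cases "z \<in> D")
      case True
      then show ?thesis using FD fD by auto
    next
      case False
      then have "z \<in> frontier D" using that cl by blast
      then show ?thesis using False Ffr frontier_notin_open[OF oD' h(1)] by simp
    qed
    show "x = y"
    proof (cases "x \<in> D")
      case True
      then have "y \<in> D" using in' xy by metis
      then show ?thesis using True xy(3) FD inj by (auto dest: inj_onD)
    next
      case False
      moreover have "y \<notin> D" using in'[OF xy(1)] in'[OF xy(2)] xy(3) False by simp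
      ultimately have fr: "x \<in> frontier D" "y \<in> frontier D" using xy(1,2) cl(1) by auto
      then have "h x = h y" using xy(3) Ffr by simp
      then show ?thesis
        using Q_homeomorphism_boundary_inj[OF assms(1,3,4) \<alpha> assms(8,9) fr h(1)[OF fr(1)] assms(12,13,17) fg]
          h(2) fr by metis
    qed
  qed
  ultimately have "\<exists>G. homeomorphism (closure D) (closure D') F G"
    by (intro homeomorphism_compact assms(10) cont)
  then show ?thesis using FD by blast
qed

end
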